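(* Let $M^n$ be a manifold of dimension $n\ge 2$ with a one-dimensional foliation, and let $L$ be a leaf which is dense in $M^n$. Then $L$, with the leaf topology, is homeomorphic either to the real line $\mathbb R$ or to the long ray $\mathbb L_+$. Furthermore $M^n$ is separable.
   Context: A manifold is a connected Hausdorff topological manifold without boundary, NOT assumed metrizable or second countable. A one-dimensional foliation is a $C^0$ foliation locally modelled on the partition of $\mathbb R^n$ into parallel lines. The closed long ray $\mathbb L_{\ge 0}$ is $\omega_1\times[0,1)$ with the lexicographic order topology, and the long ray $\mathbb L_+$ is $\mathbb L_{\ge 0}$ with its initial point removed. Separable means having a countable dense subset. *)

theory Defs
  imports "HOL-Analysis.Analysis"
begin

definition manifold :: "nat \<Rightarrow> 'a topology \<Rightarrow> bool" where
  "manifold n M \<longleftrightarrow>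
     connected_space M \<and> Hausdorff_space M \<and>
     (\<forall>p \<in> topspace M. \<exists>U V. openin M U \<and> p \<in> U \<and> openin (Euclidean_space n) V \<and>
        subtopology M U homeomorphic_space subtopology (Euclidean_space n) V)"

definition chart :: "nat \<Rightarrow> 'a topology \<Rightarrow> 'a set \<Rightarrow> ('a \<Rightarrow> nat \<Rightarrow> real) \<Rightarrow> bool" where
  "chart n M U \<phi> \<longleftrightarrow>
     openin M U \<and> openin (Euclidean_space n) (\<phi> ` U) \<and>
     homeomorphic_map (subtopology M U) (subtopology (Euclidean_space n) (\<phi> ` U)) \<phi>"

text \<open>The model foliation partitions $R^n = R \times R^{n-1}$ into the lines parallel to the
  axis of coordinate 0; the line through a point is given by its remaining coordinates.\<close>

definition transverse :: "(nat \<Rightarrow> real) \<Rightarrow> (nat \<Rightarrow> real)" where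
  "transverse x = (\<lambda>i. x (Suc i))"

text \<open>A foliation is represented by a foliated atlas, not required to be maximal. The last
  clause says that each change of charts has locally the form $(t, y) \mapsto (f(t, y), g(y))$;
  there is no condition on $f$, since changes of charts are homeomorphisms anyway.\<close>

definition foliation1 ::
    "nat \<Rightarrow> 'a topology \<Rightarrow> ('a set \<times> ('a \<Rightarrow> nat \<Rightarrow> real)) set \<Rightarrow> bool" where
  "foliation1 n M \<F> \<longleftrightarrow>
     (\<forall>(U, \<phi>) \<in> \<F>. chart n M U \<phi>) \<and>
     (\<Union>(U, \<phi>) \<in> \<F>. U) = topspace M \<and>
     (\<forall>(U, \<phi>) \<in> \<F>. \<forall>(V, \<psi>) \<in> \<F>. \<forall>p \<in> U \<inter> V.
        \<exists>W g. openin M W \<and> p \<in> W \<and> W \<subseteq> U \<inter> V \<and>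
          (\<forall>q \<in> W. transverse (\<psi> q) = g (transverse (\<phi> q))))"

text \<open>The leaf topology on the points of \<open>M\<close>: an open set of a chart domain, intersected with the
  part of the domain lying over one line of the model, is open.\<close>

definition leaf_topology ::
    "'a topology \<Rightarrow> ('a set \<times> ('a \<Rightarrow> nat \<Rightarrow> real)) set \<Rightarrow> 'a topology" where
  "leaf_topology M \<F> = topology_generated_by
     {{p \<in> W. transverse (\<phi> p) = y} | W U \<phi> y. (U, \<phi>) \<in> \<F> \<and> openin M W \<and> W \<subseteq> U}"

definition leaves :: "'a topology \<Rightarrow> ('a set \<times> ('a \<Rightarrow> nat \<Rightarrow> real)) set \<Rightarrow> 'a set set" where
  "leaves M \<F> = connected_components_of (leaf_topology M \<F>)"

text \<open>The order topology on \<open>C\<close> of a strict linear order \<open>r\<close>, generated by the open rays.\<close>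

definition order_topology :: "'b set \<Rightarrow> 'b rel \<Rightarrow> 'b topology" where
  "order_topology C r = topology_generated_by
     (insert C ((\<lambda>a. {x \<in> C. (x, a) \<in> r}) ` C \<union> (\<lambda>a. {x \<in> C. (a, x) \<in> r}) ` C))"

text \<open>\<open>omega1\<close> is the reflexive well-order of the least uncountable cardinal, identified with its
  initial ordinal; its elements are the members of its field.\<close>

definition omega1 :: "nat set rel" where
  "omega1 = cardSuc natLeq"

definition long_ray_points :: "(nat set \<times> real) set" where
  "long_ray_points = Field omega1 \<times> {0..<1}"

definition long_ray_less :: "(nat set \<times> real) rel" where
  "long_ray_less = (omega1 - Id) <*lex*> {(s, t). s < t}"

definition closed_long_ray :: "(nat set \<times> real) topology" where
  "closed_long_ray = order_topology long_ray_points long_ray_less"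

text \<open>Only the initial point has no predecessor.\<close>

definition long_ray :: "(nat set \<times> real) topology" where
  "long_ray = subtopology closed_long_ray
     {x \<in> long_ray_points. \<exists>a \<in> long_ray_points. (a, x) \<in> long_ray_less}"

end

(* The leaf L is a connected Hausdorff 1-manifold. A subset that is sequentially compact in the leaf
   topology is closed in M, and it has empty interior because n >= 2: a sequence in a transversal
   that converges in M has no subsequence converging in the leaf topology. So the dense leaf L is
   not sequentially compact; in particular it is no circle, and then any two injectively
   parametrized lines in L that meet lie in a common one. This makes L a linearly ordered space all
   of whose bounded closed intervals are real intervals. If both ends have countable cofinality,
   L is the real line. If just one has, L is the long ray, and a half-line towards the long end is
   sequentially compact, so the separable rest of L is still dense in M. If both ends are
   long, L is sequentially compact. *)

theory Submission
  imports Defs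
begin

section \<open>One-dimensional manifolds\<close>

text \<open>Compactness would be too strong a notion here: a closed half-line towards a long end is
  not compact, but every sequence in it is bounded and so has a convergent subsequence. Sequential
  compactness passes to the coarser topology of \<open>M\<close>, and since \<open>M\<close> is
  locally metrizable, sequences detect closure points there; this is why such sets are closed in
  \<open>M\<close>. The order of the leaf cannot be read off a single parametrization, as a line
  need not exhaust the leaf. It is assembled from all lines: two points of a reference line fix an
  orientation, and two oriented lines embed increasingly into a common one. From then on only the
  order is used: all topologies of curves involved are order topologies, so homeomorphisms come from
  order isomorphisms, and these come from tilings by half-open unit intervals indexed by the
  integers or by \<open>omega1\<close>.\<close>

definition seq_compactin :: "'a topology \<Rightarrow> 'a set \<Rightarrow> bool" where
  "seq_compactin X K \<longleftrightarrow> K \<subseteq> topspace X \<and>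
     (\<forall>\<sigma>::nat \<Rightarrow> 'a. range \<sigma> \<subseteq> K \<longrightarrow>
        (\<exists>q\<in>K. \<exists>r::nat \<Rightarrow> nat. strict_mono r \<and> limitin X (\<sigma> \<circ> r) q sequentially))"

lemma seq_compactinD:
  assumes "seq_compactin X K" "\<And>i. (\<sigma>::nat \<Rightarrow> 'a) i \<in> K"
  obtains q r where "q \<in> K" "strict_mono r" "limitin X (\<sigma> \<circ> r) q sequentially"
  using assms unfolding seq_compactin_def by blast

lemma seq_compactin_continuous_image:
  fixes S :: "real set"
  assumes "continuous_map (top_of_set S) X m" "compact S"
  shows "seq_compactin X (m ` S)"
  unfolding seq_compactin_def
proof (intro conjI allI impI)
  show "m ` S \<subseteq> topspace X"
    using assms(1) by (auto simp: continuous_map_def)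
  fix \<sigma> :: "nat \<Rightarrow> 'a"
  assume "range \<sigma> \<subseteq> m ` S"
  then have "\<forall>i. \<exists>t\<in>S. \<sigma> i = m t" by blast
  then obtain t where t: "\<And>i. t i \<in> S" "\<And>i. \<sigma> i = m (t i)" by metis
  obtain l r where l: "l \<in> S" "strict_mono r" "(t \<circ> r) \<longlonglongrightarrow> l"
    using assms(2) t(1) unfolding compact_def by blast
  have "limitin (top_of_set S) (t \<circ> r) l sequentially"
    using l t(1) by (simp add: limitin_subtopology)
  then have "limitin X (m \<circ> (t \<circ> r)) (m l) sequentially"
    by (rule continuous_map_limit[OF assms(1)])
  moreover have "m \<circ> (t \<circ> r) = \<sigma> \<circ> r" by (auto simp: t)
  ultimately show "\<exists>q\<in>m ` S. \<exists>r. strict_mono r \<and> limitin X (\<sigma> \<circ> r) q sequentially"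
    using l by auto
qed

text \<open>No countability axiom is imposed, and a chart only has to have open image in the reals;
  intervals are cut out of it where they are needed.\<close>

locale curve =
  fixes X :: "'a topology"
  assumes connected: "connected_space X"
    and Hausdorff: "Hausdorff_space X"
    and local_coordinate: "p \<in> topspace X \<Longrightarrow> \<exists>U (\<phi>::'a \<Rightarrow> real). openin X U \<and> p \<in> U \<and>
       open (\<phi> ` U) \<and> homeomorphic_map (subtopology X U) (top_of_set (\<phi> ` U)) \<phi>"
begin

text \<open>Read in a chart, \<open>m\<close> becomes a continuous injection of an open set of reals
  into the reals, so invariance of domain applies.\<close>

lemma openin_inj_image:
  fixes U :: "real set"
  assumes "continuous_map (top_of_set U) X m" "open U" "inj_on m U"
  shows "openin X (m ` U)"
proof (subst openin_subopen, intro ballI)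
  fix p assume "p \<in> m ` U"
  then obtain t where t: "t \<in> U" "p = m t" by blast
  have mU: "m ` U \<subseteq> topspace X" using assms(1) by (auto simp: continuous_map_def)
  then obtain V and \<phi> :: "'a \<Rightarrow> real" where V: "openin X V" "p \<in> V" "open (\<phi> ` V)"
      "homeomorphic_map (subtopology X V) (top_of_set (\<phi> ` V)) \<phi>"
    using local_coordinate t by blast
  define U' where "U' = {s \<in> U. m s \<in> V}"
  have "openin (top_of_set U) U'"
    using openin_continuous_map_preimage[OF assms(1) V(1)] by (simp add: U'_def)
  then have oU': "open U'" using assms(2) openin_open_eq by blast
  have c\<phi>: "continuous_map (subtopology X V) euclideanreal \<phi>"
    using homeomorphic_imp_continuous_map[OF V(4)] continuous_map_in_subtopology by blast
  have i\<phi>: "inj_on \<phi> V"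
    using homeomorphic_imp_injective_map[OF V(4)] openin_subset[OF V(1)] by (simp add: Int_absorb1)
  have "continuous_map (top_of_set U') (subtopology X V) m"
    using continuous_map_from_subtopology_mono[OF assms(1), of U']
    by (auto simp: U'_def continuous_map_in_subtopology)
  then have "continuous_map (top_of_set U') euclideanreal (\<phi> \<circ> m)"
    using c\<phi> continuous_map_compose by blast
  then have "continuous_on U' (\<phi> \<circ> m)" by simp
  moreover have "inj_on (\<phi> \<circ> m) U'"
    using i\<phi> assms(3) by (auto simp: U'_def inj_on_def)
  ultimately have o: "open ((\<phi> \<circ> m) ` U')"
    using oU' invariance_of_domain by blast
  have "{x \<in> topspace (subtopology X V). \<phi> x \<in> (\<phi> \<circ> m) ` U'} = m ` U'"
    using i\<phi> openin_subset[OF V(1)] by (auto simp: U'_def dest: inj_onD)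
  moreover have "openin (subtopology X V) {x \<in> topspace (subtopology X V). \<phi> x \<in> (\<phi> \<circ> m) ` U'}"
    by (rule openin_continuous_map_preimage[OF c\<phi>]) (use o in simp)
  ultimately have "openin X (m ` U')"
    using V(1) openin_trans_full by metis
  moreover have "p \<in> m ` U'" "m ` U' \<subseteq> m ` U" using t V by (auto simp: U'_def)
  ultimately show "\<exists>T. openin X T \<and> p \<in> T \<and> T \<subseteq> m ` U" by blast
qed

text \<open>Preimages under the inverse are images of open parameter sets, and these are open by
  \<open>openin_inj_image\<close>.\<close>

lemma continuous_map_local_inverse:
  fixes J :: "real set"
  assumes "continuous_map (top_of_set J) X m" "open J" "inj_on m J"
  shows "continuous_map (subtopology X (m ` J)) euclideanreal (inv_into J m)"
proof -
  have mU: "m ` J \<subseteq> topspace X" using assms(1) by (auto simp: continuous_map_def)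
  have "openin (subtopology X (m ` J)) {x \<in> topspace (subtopology X (m ` J)). inv_into J m x \<in> V}"
    if "open V" for V
  proof -
    have "{x \<in> topspace (subtopology X (m ` J)). inv_into J m x \<in> V} = m ` (J \<inter> V)"
      using mU assms(3) by (auto simp: inv_into_f_f)
    moreover have "openin X (m ` (J \<inter> V))"
    proof (rule openin_inj_image)
      show "continuous_map (top_of_set (J \<inter> V)) X m"
        by (rule continuous_map_from_subtopology_mono[OF assms(1)]) blast
      show "open (J \<inter> V)" using that assms(2) by blast
      show "inj_on m (J \<inter> V)" by (rule inj_on_subset[OF assms(3)]) blast
    qed
    ultimately show ?thesis
      by (metis subset_openin_subtopology image_mono inf_le1)
  qed
  then show ?thesis by (simp add: continuous_map_def)
qed

section \<open>Locally injective paths and their returns\<close>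

text \<open>Local injectivity is what a path glued from two lines visibly has; global injectivity is
  then derived from the absence of returns.\<close>

definition immersion :: "(real \<Rightarrow> 'a) \<Rightarrow> bool" where
  "immersion m \<longleftrightarrow> continuous_map euclideanreal X m \<and> (\<forall>t. \<exists>U. open U \<and> t \<in> U \<and> inj_on m U)"

lemma continuous_map_from_set:
  "continuous_map euclideanreal X m \<Longrightarrow> continuous_map (top_of_set S) X m"
  by (rule continuous_map_from_subtopology)

lemma immersion_open:
  assumes "immersion m" "open W"
  shows "openin X (m ` W)"
proof (subst openin_subopen, intro ballI)
  fix p assume "p \<in> m ` W"
  then obtain t where t: "t \<in> W" "p = m t" by blast
  obtain U where "open U" "t \<in> U" "inj_on m U" using assms(1) by (auto simp: immersion_def)
  then have "openin X (m ` (U \<inter> W))"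
    using assms inj_on_subset[of m U "U \<inter> W"]
    by (intro openin_inj_image) (simp_all add: immersion_def continuous_map_from_set open_Int)
  then show "\<exists>T. openin X T \<and> p \<in> T \<and> T \<subseteq> m ` W"
    using t \<open>t \<in> U\<close> by blast
qed

lemma clopen_eq_topspace:
  assumes "openin X C" "closedin X C" "C \<noteq> {}"
  shows "C = topspace X"
  using assms connected unfolding connected_space_clopen_in by blast

text \<open>Among the returns inside a compact square one has minimal length, provided that the
  diagonal is removed without losing compactness. By minimality the end points form the only return
  within \<open>{u..v}\<close>, so \<open>m\<close> traverses a simple closed curve there.\<close>

lemma closest_return:
  assumes "immersion m" "\<not> inj m"
  obtains u v where "u < v" "m u = m v"
    "\<And>u' v'. u \<le> u' \<Longrightarrow> u' < v' \<Longrightarrow> v' \<le> v \<Longrightarrow> m u' = m v' \<Longrightarrow> v' - u' \<ge> v - u"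
proof -
  have cm: "continuous_map euclideanreal X m" using assms by (simp add: immersion_def)
  obtain u0 v0 where uv: "u0 < v0" "m u0 = m v0"
    using assms(2) unfolding inj_def by (metis linorder_neqE_linordered_idom)
  define E where "E = {z::real\<times>real. m (fst z) = m (snd z)}"
  have "continuous_map euclidean X (\<lambda>z::real\<times>real. m (fst z))"
    "continuous_map euclidean X (\<lambda>z::real\<times>real. m (snd z))"
  proof -
    have "continuous_map euclidean euclideanreal (\<lambda>z::real\<times>real. fst z)"
      unfolding continuous_map_iff_continuous2 by (rule continuous_on_fst[OF continuous_on_id])
    then show "continuous_map euclidean X (\<lambda>z::real\<times>real. m (fst z))"
      using continuous_map_compose[OF _ cm] unfolding o_def by blast
    have "continuous_map euclidean euclideanreal (\<lambda>z::real\<times>real. snd z)"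
      unfolding continuous_map_iff_continuous2 by (rule continuous_on_snd[OF continuous_on_id])
    then show "continuous_map euclidean X (\<lambda>z::real\<times>real. m (snd z))"
      using continuous_map_compose[OF _ cm] unfolding o_def by blast
  qed
  note c = this
  have "m (fst z) = m (snd z)" if "z \<in> closure E" for z
  proof (rule forall_in_closure_of_eq[OF _ Hausdorff c, of z E])
    show "z \<in> euclidean closure_of E" using that by simp
    show "m (fst x) = m (snd x)" if "x \<in> E" for x using that unfolding E_def by (rule CollectD)
  qed
  then have "closure E \<subseteq> E" unfolding E_def by (intro subsetI CollectI)
  then have "closed E" using closure_subset_eq by blast
  \<comment> \<open>\<open>Q\<close> is an open neighbourhood of the diagonal without any pair of
    distinct parameters that have the same value. Removing it keeps compactness and deletes only
    trivial returns.\<close>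
  define Q where "Q = \<Union>{U \<times> U | U. open U \<and> inj_on m U}"
  have "open Q" unfolding Q_def by (auto intro: open_Times)
  define P where "P = (({u0..v0} \<times> {u0..v0}) \<inter> {z. fst z \<le> snd z} \<inter> E) - Q"
  have "closed {z::real\<times>real. fst z \<le> snd z}"
    by (intro closed_Collect_le continuous_intros)
  then have cP: "compact P"
    unfolding P_def using \<open>closed E\<close> \<open>open Q\<close>
    by (intro compact_diff compact_Int_closed compact_Times) auto
  have P_iff: "(u,v) \<in> P \<longleftrightarrow> u0 \<le> u \<and> u < v \<and> v \<le> v0 \<and> m u = m v" for u v
  proof
    assume a: "(u,v) \<in> P"
    then have "(u,v) \<notin> Q" by (simp add: P_def)
    have "u \<noteq> v"
    proof
      assume "u = v"
      obtain U where "open U" "u \<in> U" "inj_on m U" using assms(1) by (auto simp: immersion_def)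
      then have "(u,v) \<in> Q" using \<open>u = v\<close> unfolding Q_def by blast
      then show False using \<open>(u,v) \<notin> Q\<close> by blast
    qed
    then show "u0 \<le> u \<and> u < v \<and> v \<le> v0 \<and> m u = m v" using a by (auto simp: P_def E_def)
  next
    assume a: "u0 \<le> u \<and> u < v \<and> v \<le> v0 \<and> m u = m v"
    then have "(u,v) \<notin> Q" unfolding Q_def by (auto dest: inj_onD)
    then show "(u,v) \<in> P" using a by (auto simp: P_def E_def)
  qed
  have "P \<noteq> {}" using P_iff[of u0 v0] uv by auto
  then obtain z where z: "z \<in> P" "\<And>w. w \<in> P \<Longrightarrow> snd z - fst z \<le> snd w - fst w"
    using continuous_attains_inf[OF cP _ continuous_on_diff[OF continuous_on_snd[OF continuous_on_id]
          continuous_on_fst[OF continuous_on_id]]] by blast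
  obtain u v where zuv: "z = (u,v)" by (cases z)
  have uv': "u0 \<le> u" "u < v" "v \<le> v0" "m u = m v" using z(1) P_iff zuv by auto
  have "v - u \<le> v' - u'" if "u \<le> u'" "u' < v'" "v' \<le> v" "m u' = m v'" for u' v'
    using z(2)[of "(u',v')"] P_iff[of u' v'] zuv that uv' by simp
  with uv' show ?thesis by (intro that[of u v])
qed

text \<open>A shortest return closes up an arc, whose image \<open>C\<close> is compact and thus
  closed. It is also open: at the closing point the arc leaves on one side and comes back on the
  other. By connectedness \<open>C\<close> is the whole space.\<close>

lemma seq_compact_if_return:
  assumes "immersion m" "\<not> inj m"
  shows "seq_compactin X (topspace X)"
proof -
  have cm: "continuous_map euclideanreal X m" using assms by (simp add: immersion_def)
  obtain u v where uv: "u < v" "m u = m v" and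
    min: "\<And>u' v'. u \<le> u' \<Longrightarrow> u' < v' \<Longrightarrow> v' \<le> v \<Longrightarrow> m u' = m v' \<Longrightarrow> v' - u' \<ge> v - u"
    using closest_return[OF assms] by blast
  obtain U where U: "open U" "u \<in> U" "inj_on m U" using assms(1) by (auto simp: immersion_def)
  obtain e0 where e0: "e0 > 0" "ball u e0 \<subseteq> U" using U open_contains_ball by blast
  \<comment> \<open>Both \<open>e\<close> and \<open>d\<close> are bounded by half of
    \<open>v - u\<close>, so that the parameter \<open>?w\<close> below stays under
    \<open>v - d\<close> and minimality applies to this pair.\<close>
  define e where "e = min e0 ((v - u) / 2)"
  have e: "e > 0" "e \<le> (v-u)/2" using e0 uv unfolding e_def by (auto simp: min_def field_simps)
  define J where "J = {u-e<..<u+e}"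
  have "J \<subseteq> U" using e0(2) by (auto simp: J_def e_def subset_iff dist_real_def)
  then have iJ: "inj_on m J" using U inj_on_subset by blast
  have oJ: "open J" by (simp add: J_def)
  define A where "A = m ` J"
  have oA: "openin X A" unfolding A_def using assms oJ immersion_open by blast
  define B where "B = {t. m t \<in> A}"
  have "open B" using openin_continuous_map_preimage[OF cm oA] by (simp add: B_def)
  moreover have "u \<in> J" using e by (simp add: J_def)
  then have "v \<in> B" using uv(2) unfolding B_def A_def by (metis image_eqI mem_Collect_eq)
  ultimately obtain d0 where d0: "d0 > 0" "ball v d0 \<subseteq> B" using open_contains_ball by blast
  define d where "d = min d0 ((v - u) / 2) / 2"
  have d: "d > 0" "d < d0" "d < (v-u)/2" using d0 uv by (auto simp: d_def min_def field_simps)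
  \<comment> \<open>Near \<open>v\<close> the path runs inside the arc \<open>A\<close> around
    \<open>m u\<close>; \<open>\<tau>\<close> is its position there in the coordinate of that
    arc.\<close>
  define \<tau> where "\<tau> = inv_into J m \<circ> m"
  have "{v-d..v} \<subseteq> B" using d d0 by (force simp: subset_iff dist_real_def)
  then have "continuous_map (top_of_set {v-d..v}) (subtopology X A) m"
    using cm by (auto simp: continuous_map_in_subtopology B_def intro: continuous_map_from_set)
  moreover have "continuous_map (subtopology X A) euclideanreal (inv_into J m)"
    unfolding A_def by (rule continuous_map_local_inverse) (auto simp: oJ iJ cm continuous_map_from_set)
  ultimately have "continuous_map (top_of_set {v-d..v}) euclideanreal \<tau>"
    unfolding \<tau>_def using continuous_map_compose by blast
  then have c\<tau>: "continuous_on {v-d..v} \<tau>" by simp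
  have \<tau>: "m (\<tau> x) = m x" "\<tau> x \<in> J" if "x \<in> {v-d..v}" for x
    using that \<open>{v-d..v} \<subseteq> B\<close> unfolding \<tau>_def B_def A_def
    by (auto simp: f_inv_into_f inv_into_into)
  have \<tau>v: "\<tau> v = u" unfolding \<tau>_def using uv iJ e by (metis J_def comp_apply diff_less_eq
        greaterThanLessThan_iff inv_into_f_f less_add_same_cancel1)
  let ?w = "\<tau> (v-d)"
  \<comment> \<open>Coming back from the right of \<open>u\<close> would give a return from
    \<open>?w\<close> to \<open>v - d\<close>, which is shorter than \<open>v - u\<close>.\<close>
  have w: "?w < u"
  proof (rule ccontr)
    assume "\<not> ?w < u"
    then have "u \<le> ?w" "?w < u + e" using \<tau>(2)[of "v-d"] d by (auto simp: J_def)
    then show False using min[of ?w "v-d"] \<tau>(1)[of "v-d"] d e by auto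
  qed
  define C where "C = m ` {u..v}"
  \<comment> \<open>Left of \<open>u\<close> the returning end of the arc covers everything, by the
    intermediate value theorem for \<open>\<tau>\<close>; right of \<open>u\<close> its beginning
    does.\<close>
  have "m ` {?w<..<u+e} \<subseteq> C"
  proof (rule image_subsetI)
    fix t assume t: "t \<in> {?w<..<u+e}"
    show "m t \<in> C"
    proof (cases "t \<le> u")
      case True
      then obtain x where "x \<in> {v-d..v}" "\<tau> x = t"
        using IVT'[of \<tau> "v-d" t v] t \<tau>v c\<tau> d by auto
      moreover have "{v-d..v} \<subseteq> {u..v}" using d by auto
      ultimately show ?thesis using \<tau>(1)[of x] unfolding C_def by (metis imageI subsetD)
    next
      case False
      then show ?thesis using t e unfolding C_def by auto
    qed
  qed
  moreover have "m u \<in> m ` {?w<..<u+e}" using w e by auto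
  then have sub: "C \<subseteq> m ` {?w<..<u+e} \<union> m ` {u<..<v}"
  proof -
    have "{u..v} = insert u (insert v {u<..<v})" using uv(1) by auto
    then have "C = insert (m u) (m ` {u<..<v})" unfolding C_def using uv(2) by simp
    then show ?thesis using \<open>m u \<in> m ` {?w<..<u+e}\<close> by simp
  qed
  moreover have "m ` {u<..<v} \<subseteq> C" by (force simp: C_def)
  ultimately have "C = m ` {?w<..<u+e} \<union> m ` {u<..<v}" using sub by blast
  then have "openin X C" using immersion_open[OF assms(1)] by (metis open_greaterThanLessThan openin_Un)
  moreover have "compactin X C"
    unfolding C_def using image_compactin[OF _ cm] by (metis compact_Icc compactin_euclidean_iff)
  then have "closedin X C" using Hausdorff compactin_imp_closedin by blast
  moreover have "C \<noteq> {}" using uv by (auto simp: C_def)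
  ultimately have "C = topspace X" using clopen_eq_topspace by blast
  then show ?thesis
    using seq_compactin_continuous_image[of "{u..v}" X m] cm by (simp add: C_def continuous_map_from_set)
qed

end

section \<open>Lines and their gluing\<close>

context curve
begin

definition line :: "(real \<Rightarrow> 'a) \<Rightarrow> bool" where
  "line h \<longleftrightarrow> continuous_map euclideanreal X h \<and> inj h"

lemma line_cont: "line h \<Longrightarrow> continuous_map euclideanreal X h"
  by (simp add: line_def)

lemma line_inj: "line h \<Longrightarrow> inj h"
  by (simp add: line_def)

lemma line_immersion: "line h \<Longrightarrow> immersion h"
  unfolding line_def immersion_def by blast

lemma line_range: "line h \<Longrightarrow> range h \<subseteq> topspace X"
  unfolding line_def by (auto simp: continuous_map_def)

lemma line_open_range: "line h \<Longrightarrow> openin X (range h)"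
  using immersion_open[OF line_immersion, of h UNIV] by simp

lemma line_reflect: "line h \<Longrightarrow> line (\<lambda>t. h (- t))"
  unfolding line_def
  using continuous_map_compose[of euclideanreal euclideanreal uminus X h]
    inj_compose[of h "uminus :: real \<Rightarrow> real"]
  by (simp add: o_def continuous_on_minus)

lemma range_reflect: "range (\<lambda>t. h (- t)) = range (h::real \<Rightarrow> 'a)"
proof -
  have "range (\<lambda>t. h (- t)) = h ` range uminus" by (simp only: image_image)
  then show ?thesis by simp
qed

text \<open>A line is a homeomorphism onto its open range, so a path inside that range can be read
  in its parameter.\<close>

lemma line_transition:
  assumes "line h" "continuous_map (top_of_set J) X k" "k ` J \<subseteq> range h"
  shows "continuous_on J (inv h \<circ> k)"
proof -
  have "continuous_map (subtopology X (range h)) euclideanreal (inv h)"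
    using assms(1) by (intro continuous_map_local_inverse) (auto simp: line_def)
  moreover have "continuous_map (top_of_set J) (subtopology X (range h)) k"
    using assms by (auto simp: continuous_map_in_subtopology)
  ultimately have "continuous_map (top_of_set J) euclideanreal (inv h \<circ> k)"
    using continuous_map_compose by blast
  then show ?thesis by simp
qed

lemma transition_inj:
  assumes "inj_on k J" "k ` J \<subseteq> range h"
  shows "inj_on (inv h \<circ> k) J"
  using assms by (metis comp_inj_on inj_on_inv_into)

lemma continuous_inj_monotone:
  fixes f :: "real \<Rightarrow> real"
  assumes "continuous_on J f" "inj_on f J" "is_interval J"
  shows "strict_mono_on J f \<or> strict_antimono_on J f"
  using injective_eq_monotone_map[of J f] assms by simp

text \<open>If \<open>k\<close> follows \<open>h\<close> towards a point that it does not reach, then \<open>k\<close> ends there.\<close>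

lemma end_of_overlap:
  assumes h: "line h" and k: "line k" and a: "a < t0" "h a \<notin> range k"
    and sub: "h ` {a<..t0} \<subseteq> range k"
  obtains s0 where "k s0 = h t0" "k ` {..s0} = h ` {a<..t0} \<or> k ` {s0..} = h ` {a<..t0}"
proof -
  define \<tau> where "\<tau> = inv k \<circ> h"
  have k\<tau>: "k (\<tau> t) = h t" if "t \<in> {a<..t0}" for t
    unfolding \<tau>_def o_def by (rule f_inv_into_f) (use that sub in blast)
  have c: "continuous_on {a<..t0} \<tau>"
    unfolding \<tau>_def by (rule line_transition[OF k continuous_map_from_set[OF line_cont[OF h]] sub])
  have i: "inj_on \<tau> {a<..t0}"
    unfolding \<tau>_def by (rule transition_inj[OF _ sub]) (meson h inj_on_subset line_inj subset_UNIV)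
  have int: "is_interval {a<..t0}" by (simp add: is_interval_1)
  define J where "J = \<tau> ` {a<..t0}"
  define s0 where "s0 = \<tau> t0"
  have kJ: "k ` J = h ` {a<..t0}" unfolding J_def image_image using k\<tau> by (intro image_cong) auto
  have ks0: "k s0 = h t0" using k\<tau>[of t0] a by (simp add: s0_def)
  have s0J: "s0 \<in> J" using a by (simp add: J_def s0_def)
  have J_int: "is_interval J" unfolding J_def
    using connected_continuous_image[OF c] int by (simp add: is_interval_connected_1)
  \<comment> \<open>A bounded \<open>J\<close> would have a compact closure. Its image under
    \<open>k\<close> would be closed in the Hausdorff space \<open>X\<close> and so contain the
    limit \<open>h a\<close>, which \<open>k\<close> does not reach.\<close>
  have "\<not> bounded J"
  proof
    assume "bounded J"
    then have "compact (closure J)" by simp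
    then have "compactin X (k ` closure J)"
      using image_compactin[OF _ line_cont[OF k]] by (metis compactin_euclidean_iff)
    then have cl: "closedin X (k ` closure J)" using Hausdorff compactin_imp_closedin by blast
    have "closedin euclideanreal {t \<in> topspace euclideanreal. h t \<in> k ` closure J}"
      by (rule closedin_continuous_map_preimage[OF line_cont[OF h] cl])
    then have cl': "closed {t. h t \<in> k ` closure J}" by simp
    have "h ` {a<..t0} \<subseteq> k ` closure J" using kJ closure_subset by blast
    then have "{a<..t0} \<subseteq> {t. h t \<in> k ` closure J}" by blast
    then have "closure {a<..t0} \<subseteq> {t. h t \<in> k ` closure J}"
      using cl' closure_minimal by blast
    moreover have "a \<in> closure {a<..t0}" using a by simp
    ultimately have "h a \<in> k ` closure J" by blast
    then show False using a by blast
  qed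
  have "strict_mono_on {a<..t0} \<tau> \<or> strict_antimono_on {a<..t0} \<tau>"
    by (rule continuous_inj_monotone[OF c i int])
  \<comment> \<open>The end \<open>t0\<close> belongs to the domain, so \<open>s0\<close> is the
    largest or the smallest element of the interval \<open>J\<close>, which must be unbounded on the
    other side.\<close>
  then have "J = {..s0} \<or> J = {s0..}"
  proof
    assume mono: "strict_mono_on {a<..t0} \<tau>"
    have mon: "t = t0 \<or> \<tau> t < s0" if "t \<in> {a<..t0}" for t
    proof (cases "t = t0")
      case False
      then have "t < t0" "t0 \<in> {a<..t0}" using that a by auto
      from monotone_onD[OF mono that this(2,1)] show ?thesis by (simp add: s0_def)
    qed simp
    have le: "J \<subseteq> {..s0}"
      unfolding J_def
    proof (rule image_subsetI)
      fix t assume "t \<in> {a<..t0}"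
      from mon[OF this] show "\<tau> t \<in> {..s0}" by (auto simp: s0_def)
    qed
    have "{..s0} \<subseteq> J"
    proof
      fix s assume s: "s \<in> {..s0}"
      have "\<exists>s'\<in>J. s' \<le> s"
      proof (rule ccontr)
        assume "\<not> (\<exists>s'\<in>J. s' \<le> s)"
        then have "\<forall>x\<in>J. s \<le> x" by (meson linear)
        then have "J \<subseteq> {s..s0}" using le by (meson atLeastAtMost_iff atMost_iff subset_iff)
        then show False using \<open>\<not> bounded J\<close> bounded_subset[OF bounded_closed_interval] by blast
      qed
      then show "s \<in> J" using J_int s0J s unfolding is_interval_1 by (meson atMost_iff atLeast_iff)
    qed
    with le show ?thesis by blast
  next
    assume anti: "strict_antimono_on {a<..t0} \<tau>"
    have mon: "t = t0 \<or> s0 < \<tau> t" if "t \<in> {a<..t0}" for t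
    proof (cases "t = t0")
      case False
      then have "t < t0" "t0 \<in> {a<..t0}" using that a by auto
      from monotone_onD[OF anti that this(2,1)] show ?thesis by (simp add: s0_def)
    qed simp
    have le: "J \<subseteq> {s0..}"
      unfolding J_def
    proof (rule image_subsetI)
      fix t assume "t \<in> {a<..t0}"
      from mon[OF this] show "\<tau> t \<in> {s0..}" by (auto simp: s0_def)
    qed
    have "{s0..} \<subseteq> J"
    proof
      fix s assume s: "s \<in> {s0..}"
      have "\<exists>s'\<in>J. s \<le> s'"
      proof (rule ccontr)
        assume "\<not> (\<exists>s'\<in>J. s \<le> s')"
        then have "\<forall>x\<in>J. x \<le> s" by (meson linear)
        then have "J \<subseteq> {s0..s}" using le by (meson atLeastAtMost_iff atLeast_iff subset_iff)
        then show False using \<open>\<not> bounded J\<close> bounded_subset[OF bounded_closed_interval] by blast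
      qed
      then show "s \<in> J" using J_int s0J s unfolding is_interval_1 by (meson atMost_iff atLeast_iff)
    qed
    with le show ?thesis by blast
  qed
  then show ?thesis using that[OF ks0] kJ by blast
qed

text \<open>As \<open>range k\<close> is open, the parameters in \<open>{t..t0}\<close> at which
  \<open>h\<close> is off \<open>k\<close> form a compact set, and its supremum is the parameter
  wanted.\<close>

lemma first_exit:
  assumes h: "line h" and k: "line k" and "h t0 \<in> range k" "h t \<notin> range k" "t < t0"
  obtains a where "a < t0" "h a \<notin> range k" "h ` {a<..t0} \<subseteq> range k"
proof -
  have "open {t. h t \<in> range k}"
    using openin_continuous_map_preimage[OF line_cont[OF h] line_open_range[OF k]] by simp
  then have "closed (- {t. h t \<in> range k})" by blast
  then have "closed ({t. h t \<notin> range k} \<inter> {t..t0})"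
    by (simp add: Collect_neg_eq closed_Int)
  moreover have ne: "{t. h t \<notin> range k} \<inter> {t..t0} \<noteq> {}" using assms by auto
  moreover have bd: "bdd_above ({t. h t \<notin> range k} \<inter> {t..t0})" by (meson bdd_above_Icc bdd_above_Int2)
  ultimately have S: "Sup ({t. h t \<notin> range k} \<inter> {t..t0}) \<in> {t. h t \<notin> range k} \<inter> {t..t0}"
    by (intro closed_contains_Sup)
  define a where "a = Sup ({t. h t \<notin> range k} \<inter> {t..t0})"
  have a: "h a \<notin> range k" "t \<le> a" "a \<le> t0" using S unfolding a_def by auto
  moreover have "a \<noteq> t0" using a assms by auto
  moreover have "h x \<in> range k" if "a < x" "x \<le> t0" for x
  proof (rule ccontr)
    assume "h x \<notin> range k"
    then have "x \<in> {t. h t \<notin> range k} \<inter> {t..t0}" using that a by auto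
    then have "x \<le> a" unfolding a_def using bd by (rule cSup_upper)
    with that show False by simp
  qed
  ultimately show ?thesis by (intro that[of a]) auto
qed

text \<open>Following \<open>h\<close> up to \<open>t0\<close> and \<open>k\<close> from there on is an immersion, hence a line, since a
  return to an earlier point would make \<open>X\<close> a circle.\<close>

lemma glue_oriented:
  assumes nc: "\<not> seq_compactin X (topspace X)" and h: "line h" and k: "line k"
    and nsub: "\<not> range k \<subseteq> range h" and a: "a < t0"
    and s0: "k s0 = h t0" "k ` {..s0} = h ` {a<..t0}"
  shows "\<exists>m. line m \<and> range h \<union> range k \<subseteq> range m"
proof -
  define m where "m = (\<lambda>t. if t \<le> t0 then h t else k (t - t0 + s0))"
  have cm: "continuous_map euclideanreal X m"
    unfolding m_def
  proof (rule continuous_map_cases_le)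
    show "continuous_map (subtopology euclideanreal {x \<in> topspace euclideanreal. t0 \<le> x}) X (\<lambda>t. k (t - t0 + s0))"
      using continuous_map_compose[OF _ line_cont[OF k], of euclideanreal "\<lambda>t. t - t0 + s0"]
      by (intro continuous_map_from_set) (simp add: o_def continuous_on_add continuous_on_diff)
  qed (use s0 in \<open>auto intro: continuous_map_from_set line_cont[OF h]\<close>)
  have ih: "h x = h y \<longleftrightarrow> x = y" for x y using line_inj[OF h] by (simp add: inj_eq)
  have ik: "k x = k y \<longleftrightarrow> x = y" for x y using line_inj[OF k] by (simp add: inj_eq)
  \<comment> \<open>Between \<open>a\<close> and \<open>t0\<close> the line \<open>h\<close> traces
    exactly the part of \<open>k\<close> up to \<open>s0\<close>, which the later part of
    \<open>k\<close> avoids; this makes \<open>m\<close> injective around the joint.\<close>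
  have disj: "h x \<noteq> k y" if "a < x" "x \<le> t0" "s0 < y" for x y
  proof
    assume "h x = k y"
    then have "k y \<in> k ` {..s0}" using that unfolding s0(2) by (intro image_eqI[of _ _ x]) auto
    then show False using that ik by auto
  qed
  have "inj_on m {a<..}"
  proof (rule inj_onI)
    fix x y assume xy: "x \<in> {a<..}" "y \<in> {a<..}" "m x = m y"
    show "x = y"
    proof (cases "x \<le> t0")
      case True
      then show ?thesis
        using xy disj[of x "y - t0 + s0"] by (cases "y \<le> t0") (simp_all add: m_def ih)
    next
      case False
      then show ?thesis
        using xy disj[of y "x - t0 + s0"] by (cases "y \<le> t0") (simp_all add: m_def ik)
    qed
  qed
  moreover have "inj_on m {..<t0}" unfolding inj_on_def m_def by (auto simp: ih)
  ultimately have "\<exists>U. open U \<and> t \<in> U \<and> inj_on m U" for t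
  proof (cases "t < t0")
    case True
    with \<open>inj_on m {..<t0}\<close> show ?thesis by (intro exI[of _ "{..<t0}"]) simp
  next
    case False
    with \<open>inj_on m {a<..}\<close> a show ?thesis by (intro exI[of _ "{a<..}"]) simp
  qed
  then have "immersion m" using cm by (simp add: immersion_def)
  then have "line m" using nc seq_compact_if_return cm unfolding line_def by blast
  have "range k = k ` ({..s0} \<union> {s0..})" by (rule arg_cong[where f = "image k"]) auto
  then have range_k: "range k = k ` {..s0} \<union> k ` {s0..}" by (simp only: image_Un)
  have m1: "h ` {..t0} \<subseteq> range m"
  proof (rule image_subsetI)
    fix t assume "t \<in> {..t0}"
    then have "h t = m t" by (simp add: m_def)
    then show "h t \<in> range m" by blast
  qed
  have m2: "k ` {s0..} \<subseteq> range m"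
  proof (rule image_subsetI)
    fix s assume "s \<in> {s0..}"
    then have "k s = m (s - s0 + t0)" unfolding m_def using s0 by auto
    then show "k s \<in> range m" by blast
  qed
  have "{a<..t0} \<subseteq> {..t0}" by auto
  then have "k ` {..s0} \<subseteq> range m" using m1 unfolding s0(2) by blast
  then have rk: "range k \<subseteq> range m" using m2 unfolding range_k by blast
  \<comment> \<open>\<open>m\<close> drops the part of \<open>h\<close> after \<open>t0\<close>. If
    that part left \<open>range m\<close>, it would leave \<open>k\<close>, and by
    \<open>end_of_overlap\<close> for the reversed \<open>h\<close> it would first follow one of the
    halves of \<open>k\<close> at \<open>s0\<close> to its end. The half before \<open>s0\<close> is
    already traced by \<open>h\<close> before \<open>t0\<close>, and the half after
    \<open>s0\<close> would put all of \<open>k\<close> into \<open>range h\<close>.\<close>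
  have "range h \<subseteq> range m"
  proof (rule ccontr)
    assume "\<not> range h \<subseteq> range m"
    then obtain b where b: "h b \<notin> range m" by blast
    have "b > t0"
    proof (rule ccontr)
      assume "\<not> b > t0"
      then have "h b \<in> h ` {..t0}" by simp
      with m1 b show False by blast
    qed
    have h': "line (\<lambda>t. h (- t))" by (rule line_reflect[OF h])
    obtain a' where a': "a' < - t0" "h (- a') \<notin> range k" "(\<lambda>t. h (-t)) ` {a'<..-t0} \<subseteq> range k"
    proof (rule first_exit[OF h' k, of "-t0" "-b"])
      have "k s0 \<in> range k" by blast
      then show "h (- (- t0)) \<in> range k" using s0(1) by simp
      show "h (- (- b)) \<notin> range k" using b rk by auto
      show "- b < - t0" using \<open>b > t0\<close> by simp
    qed
    obtain s1 where s1: "k s1 = h (- (- t0))"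
      "k ` {..s1} = (\<lambda>t. h (-t)) ` {a'<..-t0} \<or> k ` {s1..} = (\<lambda>t. h (-t)) ` {a'<..-t0}"
      using end_of_overlap[OF h' k a'] by blast
    have "k s1 = k s0" using s1(1) s0(1) by simp
    then have "s1 = s0" by (simp only: ik)
    from s1(2) show False
    proof
      assume *: "k ` {..s1} = (\<lambda>t. h (-t)) ` {a'<..-t0}"
      have "h ((a + t0)/2) \<in> k ` {..s0}" using a unfolding s0(2) by (intro imageI) simp
      then obtain x where "x \<in> {a'<..-t0}" "h ((a + t0)/2) = h (- x)"
        using * unfolding \<open>s1 = s0\<close> by auto
      then show False using a by (simp add: ih)
    next
      assume "k ` {s1..} = (\<lambda>t. h (-t)) ` {a'<..-t0}"
      then have "k ` {s0..} \<subseteq> range h" unfolding \<open>s1 = s0\<close> by auto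
      moreover have "k ` {..s0} \<subseteq> range h" unfolding s0(2) by blast
      ultimately have "range k \<subseteq> range h" unfolding range_k by blast
      then show False using nsub by blast
    qed
  qed
  then show ?thesis using \<open>line m\<close> rk by blast
qed

text \<open>If neither range contains the other, \<open>h\<close> leaves \<open>range k\<close> on
  some side of a common point. Reversing \<open>h\<close> puts the exit before that point, and
  reversing \<open>k\<close> makes it continue \<open>h\<close> beyond it, so that only the
  situation of \<open>glue_oriented\<close> remains.\<close>

lemma glue:
  assumes nc: "\<not> seq_compactin X (topspace X)" and h: "line h" and k: "line k"
    and meet: "range h \<inter> range k \<noteq> {}"
  shows "\<exists>m. line m \<and> range h \<union> range k \<subseteq> range m"
proof (cases "range h \<subseteq> range k \<or> range k \<subseteq> range h")
  case True
  then show ?thesis using h k by blast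
next
  case False
  have *: "\<exists>m. line m \<and> range h \<union> range k \<subseteq> range m"
    if h: "line h" and t: "h t0 \<in> range k" "h t \<notin> range k" "t < t0"
      and nsub: "\<not> range k \<subseteq> range h" for h t t0
  proof -
    obtain a where a: "a < t0" "h a \<notin> range k" "h ` {a<..t0} \<subseteq> range k"
      using first_exit[OF h k t] .
    obtain s0 where s0: "k s0 = h t0" "k ` {..s0} = h ` {a<..t0} \<or> k ` {s0..} = h ` {a<..t0}"
      using end_of_overlap[OF h k a] .
    from s0(2) show ?thesis
    proof
      assume "k ` {..s0} = h ` {a<..t0}"
      from glue_oriented[OF nc h k nsub a(1) s0(1) this] show ?thesis .
    next
      assume *: "k ` {s0..} = h ` {a<..t0}"
      have "(\<lambda>t. k (- t)) ` {..- s0} = k ` uminus ` {..- s0}" by (simp only: image_image)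
      also have "uminus ` {..- s0} = {s0..}" by simp
      finally have **: "(\<lambda>t. k (- t)) ` {..- s0} = h ` {a<..t0}" using * by simp
      show ?thesis
        using glue_oriented[OF nc h line_reflect[OF k] _ a(1) _ **] nsub s0(1)
        by (simp add: range_reflect)
    qed
  qed
  obtain t0 where t0: "h t0 \<in> range k" using meet by blast
  obtain t where t: "h t \<notin> range k" using False by blast
  then have "t \<noteq> t0" using t0 by blast
  then consider "t < t0" | "- t < - t0" by linarith
  then show ?thesis
  proof cases
    case 1
    then show ?thesis using *[OF h t0 t] False by blast
  next
    case 2
    then show ?thesis using *[OF line_reflect[OF h], of "-t0" "-t"] t0 t False
      by (simp add: range_reflect)
  qed
qed

end

section \<open>The order of a noncompact curve\<close>

text \<open>The last clause is order convexity: it turns an interval of the order between two points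
  of the line into a real interval.\<close>

definition increasing_line :: "'a topology \<Rightarrow> 'a rel \<Rightarrow> (real \<Rightarrow> 'a) \<Rightarrow> bool" where
  "increasing_line X r h \<longleftrightarrow>
     continuous_map euclideanreal X h \<and> (\<forall>U. open U \<longrightarrow> openin X (h ` U)) \<and>
     (\<forall>s t. (h s, h t) \<in> r \<longleftrightarrow> s < t) \<and>
     (\<forall>s t y. (h s, y) \<in> r \<longrightarrow> (y, h t) \<in> r \<longrightarrow> y \<in> range h)"

text \<open>Any two points lie on a convex copy of the real line; nothing is assumed about the ends.
  The axioms are symmetric under reversal of the order, so each statement about the upper end yields
  one about the lower end.\<close>

locale ordered_curve =
  fixes X :: "'a topology" and r :: "'a rel"
  assumes in_space: "(x, y) \<in> r \<Longrightarrow> x \<in> topspace X \<and> y \<in> topspace X"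
    and irrefl: "(x, x) \<notin> r"
    and trans: "(x, y) \<in> r \<Longrightarrow> (y, z) \<in> r \<Longrightarrow> (x, z) \<in> r"
    and total: "x \<in> topspace X \<Longrightarrow> y \<in> topspace X \<Longrightarrow> x = y \<or> (x, y) \<in> r \<or> (y, x) \<in> r"
    and ex_increasing_line: "x \<in> topspace X \<Longrightarrow> y \<in> topspace X \<Longrightarrow>
      \<exists>h. increasing_line X r h \<and> x \<in> range h \<and> y \<in> range h"

locale noncompact_curve = curve +
  assumes noncompact: "\<not> seq_compactin X (topspace X)"
begin

text \<open>The image of a chart contains a ball around the coordinate of \<open>p\<close>, and
  \<open>arctan\<close> squeezes the real line into it.\<close>

lemma ex_line_through:
  assumes "p \<in> topspace X"
  shows "\<exists>h. line h \<and> p \<in> range h"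
proof -
  obtain U and \<phi> :: "'a \<Rightarrow> real" where U: "openin X U" "p \<in> U" "open (\<phi> ` U)"
      "homeomorphic_map (subtopology X U) (top_of_set (\<phi> ` U)) \<phi>"
    using local_coordinate[OF assms] by blast
  obtain g where g: "homeomorphic_maps (subtopology X U) (top_of_set (\<phi> ` U)) \<phi> g"
    using U(4) homeomorphic_map_maps by blast
  have gc: "continuous_map (top_of_set (\<phi> ` U)) X g"
    using g unfolding homeomorphic_maps_def by (auto simp: continuous_map_in_subtopology)
  have \<phi>g: "\<phi> (g y) = y" if "y \<in> \<phi> ` U" for y
    using g that unfolding homeomorphic_maps_def by auto
  have g\<phi>: "g (\<phi> p) = p"
    using g U(2) assms unfolding homeomorphic_maps_def by simp
  obtain e where e: "e > 0" "ball (\<phi> p) e \<subseteq> \<phi> ` U" using U open_contains_ball by blast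
  \<comment> \<open>As \<open>arctan\<close> takes values of modulus below 2, the factor
    \<open>e / 2\<close> keeps \<open>\<psi>\<close> within distance \<open>e\<close> of
    \<open>\<phi> p\<close>.\<close>
  define \<psi> where "\<psi> = (\<lambda>t. \<phi> p + e / 2 * arctan t)"
  have \<psi>in: "\<psi> t \<in> \<phi> ` U" for t
  proof -
    have "\<bar>arctan t\<bar> < 2" using arctan_ubound[of t] arctan_lbound[of t] pi_less_4 by linarith
    then have "\<bar>e / 2 * arctan t\<bar> < e" using e by (simp add: abs_mult)
    then have "\<psi> t \<in> ball (\<phi> p) e" by (simp add: \<psi>_def dist_real_def)
    then show ?thesis using e by blast
  qed
  have "continuous_on UNIV \<psi>" unfolding \<psi>_def by (intro continuous_intros)
  then have "continuous_map euclideanreal (top_of_set (\<phi> ` U)) \<psi>"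
    unfolding continuous_map_in_subtopology continuous_map_iff_continuous2 using \<psi>in by blast
  then have "continuous_map euclideanreal X (g \<circ> \<psi>)"
    using gc by (rule continuous_map_compose)
  moreover have "inj (g \<circ> \<psi>)"
  proof (rule injI)
    fix s t assume "(g \<circ> \<psi>) s = (g \<circ> \<psi>) t"
    then have "\<phi> (g (\<psi> s)) = \<phi> (g (\<psi> t))" by simp
    then have "\<psi> s = \<psi> t" by (simp only: \<phi>g[OF \<psi>in])
    then have "arctan s = arctan t" using e unfolding \<psi>_def by simp
    then show "s = t" by (simp only: arctan_eq_iff)
  qed
  moreover have "(g \<circ> \<psi>) 0 = p" using g\<phi> by (simp add: \<psi>_def)
  then have "p \<in> range (g \<circ> \<psi>)" by (metis rangeI)
  ultimately show ?thesis unfolding line_def by blast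
qed

text \<open>The union of all lines through \<open>p\<close> is open, and by \<open>glue\<close> a
  line that meets it is contained in it. So its complement is open as well, and connectedness does
  the rest.\<close>

lemma ex_line_through_pair:
  assumes p: "p \<in> topspace X" and q: "q \<in> topspace X"
  shows "\<exists>h. line h \<and> p \<in> range h \<and> q \<in> range h"
proof -
  define S where "S = \<Union>{range h | h. line h \<and> p \<in> range h}"
  have oS: "openin X S" unfolding S_def by (auto intro: line_open_range)
  have "openin X (topspace X - S)"
  proof (subst openin_subopen, intro ballI)
    fix x assume x: "x \<in> topspace X - S"
    then obtain k where k: "line k" "x \<in> range k" using ex_line_through[of x] by blast
    have "range k \<inter> S = {}"
    proof (rule ccontr)
      assume "range k \<inter> S \<noteq> {}"
      then obtain h where h: "line h" "p \<in> range h" "range h \<inter> range k \<noteq> {}" unfolding S_def by blast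
      obtain m where m: "line m" "range h \<union> range k \<subseteq> range m"
        using glue[OF noncompact h(1) k(1) h(3)] by blast
      have "x \<in> range m" "p \<in> range m" using h(2) k(2) m(2) by auto
      then have "x \<in> S" unfolding S_def using m(1) by (intro UnionI[of "range m"] CollectI exI[of _ m] conjI refl)
      with x show False by blast
    qed
    then have "range k \<subseteq> topspace X - S" using line_range[OF k(1)] by blast
    then show "\<exists>T. openin X T \<and> x \<in> T \<and> T \<subseteq> topspace X - S"
      using line_open_range[OF k(1)] k(2) by (intro exI[of _ "range k"] conjI)
  qed
  then have "closedin X S" using oS openin_subset by (simp add: closedin_def)
  moreover have "p \<in> S"
  proof -
    obtain h where "line h" "p \<in> range h" using ex_line_through[OF p] by blast
    then show ?thesis unfolding S_def by (intro UnionI[of "range h"] CollectI exI[of _ h] conjI refl)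
  qed
  ultimately have "S = topspace X" using clopen_eq_topspace oS by blast
  then show ?thesis using q unfolding S_def by blast
qed

text \<open>All lines used pass through \<open>p\<close>, so any two of them meet and can be
  glued.\<close>

lemma ex_line_through_finite:
  assumes "finite F" "F \<subseteq> topspace X" "p \<in> topspace X"
  shows "\<exists>h. line h \<and> insert p F \<subseteq> range h"
  using assms(1,2)
proof (induction F)
  case empty
  then show ?case using ex_line_through[OF assms(3)] by blast
next
  case (insert x F)
  then obtain h where h: "line h" "insert p F \<subseteq> range h" by blast
  obtain k where k: "line k" "p \<in> range k" "x \<in> range k"
    using ex_line_through_pair[OF assms(3)] insert.prems by blast
  have "range h \<inter> range k \<noteq> {}" using h k by blast
  then obtain m where "line m" "range h \<union> range k \<subseteq> range m"
    using glue[OF noncompact h(1) k(1)] by blast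
  then show ?case using h k by blast
qed

section \<open>Orientation and the linear order\<close>

text \<open>Only the points \<open>b 0\<close> and \<open>b 1\<close> of the reference line matter:
  passing through the first before the second fixes a direction. Two oriented lines always meet, so
  they can be compared inside a common line.\<close>

definition oriented :: "(real \<Rightarrow> 'a) \<Rightarrow> (real \<Rightarrow> 'a) \<Rightarrow> bool" where
  "oriented b h \<longleftrightarrow> line h \<and> (\<exists>s t. s < t \<and> h s = b 0 \<and> h t = b 1)"

definition line_less :: "(real \<Rightarrow> 'a) \<Rightarrow> 'a rel" where
  "line_less b = {(h s, h t) | h s t. oriented b h \<and> s < t}"

lemma oriented_imp_line: "oriented b h \<Longrightarrow> line h"
  by (simp add: oriented_def)

lemma ex_oriented_range:
  assumes "line b" "line h" "b 0 \<in> range h" "b 1 \<in> range h"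
  shows "\<exists>k. oriented b k \<and> range k = range h"
proof -
  obtain s t where st: "h s = b 0" "h t = b 1" using assms by (metis imageE)
  have "s \<noteq> t" using st line_inj[OF assms(1)] by (metis inj_eq zero_neq_one)
  then consider "s < t" | "- s < - t" by linarith
  then show ?thesis
  proof cases
    case 1
    then show ?thesis using st assms(2) unfolding oriented_def by blast
  next
    case 2
    then have "oriented b (\<lambda>t. h (- t))"
      unfolding oriented_def using st line_reflect[OF assms(2)] by (metis minus_minus)
    then show ?thesis using range_reflect by blast
  qed
qed

lemma ex_oriented_extending:
  assumes b: "line b" and h: "line h" "b 0 \<in> range h" "b 1 \<in> range h" and k: "line k" "b 0 \<in> range k"
  shows "\<exists>m. oriented b m \<and> range h \<union> range k \<subseteq> range m"
proof -
  obtain m where m: "line m" "range h \<union> range k \<subseteq> range m"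
    using glue[OF noncompact h(1) k(1)] h k by blast
  then show ?thesis using ex_oriented_range[OF b m(1)] h by blast
qed

lemma oriented_ends: "oriented b h \<Longrightarrow> b 0 \<in> range h \<and> b 1 \<in> range h"
  unfolding oriented_def by (metis rangeI)

lemma ex_oriented_through:
  assumes b: "line b" and F: "finite F" "F \<subseteq> topspace X"
  shows "\<exists>m. oriented b m \<and> F \<subseteq> range m"
proof -
  have "b 0 \<in> topspace X" "b 1 \<in> topspace X" using line_range[OF b] by blast+
  then obtain h where h: "line h" "insert (b 0) (insert (b 1) F) \<subseteq> range h"
    using ex_line_through_finite[of "insert (b 1) F" "b 0"] F by blast
  then show ?thesis using ex_oriented_range[OF b h(1)] by blast
qed

text \<open>The change of parameter is continuous and injective, hence monotone. It keeps the order
  of the parameters of \<open>b 0\<close> and \<open>b 1\<close>, so it cannot be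
  decreasing.\<close>

lemma oriented_transition:
  assumes h: "oriented b h" and m: "oriented b m" and sub: "range h \<subseteq> range m"
  shows "strict_mono (inv m \<circ> h)" "continuous_on UNIV (inv m \<circ> h)" "m ((inv m \<circ> h) t) = h t"
proof -
  note lh = oriented_imp_line[OF h] and lm = oriented_imp_line[OF m]
  show c: "continuous_on UNIV (inv m \<circ> h)"
    by (rule line_transition[OF lm continuous_map_from_set[OF line_cont[OF lh]] sub])
  have i: "inj (inv m \<circ> h)" by (rule transition_inj[OF line_inj[OF lh] sub])
  have "h t \<in> range m" for t using sub by blast
  then show mh: "m ((inv m \<circ> h) t) = h t" for t by (simp add: f_inv_into_f)
  obtain s t where st: "s < t" "h s = b 0" "h t = b 1" using h unfolding oriented_def by blast
  obtain s' t' where st': "s' < t'" "m s' = b 0" "m t' = b 1" using m unfolding oriented_def by blast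
  have "(inv m \<circ> h) s = s'" "(inv m \<circ> h) t = t'"
    using st st' line_inj[OF lm] by (simp_all add: inv_f_eq)
  then have "\<not> strict_antimono_on UNIV (inv m \<circ> h)"
    using st st' unfolding monotone_on_def by (metis UNIV_I not_less_iff_gr_or_eq)
  then show "strict_mono (inv m \<circ> h)"
    using continuous_inj_monotone[OF c i] by (simp add: is_interval_univ)
qed

text \<open>The order does not depend on the oriented line that witnesses it, because two oriented
  lines sit increasingly in a common one.\<close>

lemma line_less_iff:
  assumes b: "line b" and h: "oriented b h"
  shows "(h s, h t) \<in> line_less b \<longleftrightarrow> s < t"
proof
  assume "s < t"
  then show "(h s, h t) \<in> line_less b" unfolding line_less_def using h by blast
next
  assume "(h s, h t) \<in> line_less b"
  then obtain k s' t' where k: "oriented b k" "s' < t'" "k s' = h s" "k t' = h t"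
    unfolding line_less_def by auto
  obtain m where m: "oriented b m" "range h \<union> range k \<subseteq> range m"
    using ex_oriented_extending[OF b oriented_imp_line[OF h] _ _ oriented_imp_line[OF k(1)]]
      oriented_ends[OF h] oriented_ends[OF k(1)] by blast
  have "strict_mono (inv m \<circ> h)" "strict_mono (inv m \<circ> k)"
    using oriented_transition(1)[OF h m(1)] oriented_transition(1)[OF k(1) m(1)] m(2) by auto
  then have "(inv m \<circ> k) s' < (inv m \<circ> k) t' \<longleftrightarrow> s' < t'" "(inv m \<circ> h) s < (inv m \<circ> h) t \<longleftrightarrow> s < t"
    using strict_mono_less by blast+
  then show "s < t" using k by simp
qed

text \<open>Convexity is seen in an oriented line \<open>m\<close> that contains \<open>h\<close>
  and the intermediate point: the parameter change from \<open>h\<close> to \<open>m\<close> is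
  continuous, so it takes every value between two of its values.\<close>

lemma oriented_increasing:
  assumes b: "line b" and h: "oriented b h"
  shows "increasing_line X (line_less b) h"
  unfolding increasing_line_def
proof (intro conjI allI impI)
  note lh = oriented_imp_line[OF h]
  show "continuous_map euclideanreal X h" by (rule line_cont[OF lh])
  show "openin X (h ` U)" if "open U" for U
    using immersion_open[OF line_immersion[OF lh] that] .
  show "(h s, h t) \<in> line_less b \<longleftrightarrow> s < t" for s t by (rule line_less_iff[OF b h])
  fix s t y
  assume sy: "(h s, y) \<in> line_less b" and yt: "(y, h t) \<in> line_less b"
  obtain k s' t' where k: "oriented b k" "y = k t'"
    using sy unfolding line_less_def by auto
  obtain m where m: "oriented b m" "range h \<union> range k \<subseteq> range m"
    using ex_oriented_extending[OF b lh _ _ oriented_imp_line[OF k(1)]]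
      oriented_ends[OF h] oriented_ends[OF k(1)] by blast
  have "range h \<subseteq> range m" using m(2) by blast
  note tr = oriented_transition[OF h m(1) this]
  obtain u where u: "y = m u" using k(2) m(2) by blast
  let ?\<sigma> = "inv m \<circ> h"
  have "(m (?\<sigma> s), m u) \<in> line_less b" using sy by (simp only: tr(3) u)
  then have 1: "?\<sigma> s < u" by (simp only: line_less_iff[OF b m(1)])
  have "(m u, m (?\<sigma> t)) \<in> line_less b" using yt by (simp only: tr(3) u)
  then have 2: "u < ?\<sigma> t" by (simp only: line_less_iff[OF b m(1)])
  from 1 2 have "s < t" using strict_mono_less[OF tr(1)] by (meson order_less_trans)
  then obtain x where "?\<sigma> x = u"
    using IVT'[of ?\<sigma> s u t] 1 2 continuous_on_subset[OF tr(2)] by (metis less_imp_le subset_UNIV)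
  then have "h x = y" using tr(3)[of x] u by simp
  then show "y \<in> range h" by blast
qed

text \<open>Finitely many points lie on one oriented line, where the axioms of a strict linear order
  are those of the reals.\<close>

lemma ordered_curve_line_less:
  assumes b: "line b"
  shows "ordered_curve X (line_less b)"
proof
  fix x y z
  show sp: "x \<in> topspace X \<and> y \<in> topspace X" if "(x, y) \<in> line_less b" for x y
    using that line_range[OF oriented_imp_line] unfolding line_less_def by blast
  show "(x, x) \<notin> line_less b"
  proof
    assume *: "(x, x) \<in> line_less b"
    then obtain h s t where "oriented b h" "x = h s" unfolding line_less_def by auto
    then show False using * line_less_iff[OF b] by blast
  qed
  show "(x, z) \<in> line_less b" if xyz: "(x, y) \<in> line_less b" "(y, z) \<in> line_less b"
  proof -
    obtain m where m: "oriented b m" "{x,y,z} \<subseteq> range m"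
      using ex_oriented_through[OF b, of "{x,y,z}"] sp[OF xyz(1)] sp[OF xyz(2)] by blast
    then have "x \<in> range m" "y \<in> range m" "z \<in> range m" by auto
    then obtain s t u where e: "x = m s" "y = m t" "z = m u" by (elim rangeE)
    show ?thesis using xyz unfolding e line_less_iff[OF b m(1)] by simp
  qed
  assume xy: "x \<in> topspace X" "y \<in> topspace X"
  then obtain m where m: "oriented b m" "{x,y} \<subseteq> range m"
    using ex_oriented_through[OF b, of "{x,y}"] by blast
  then show "\<exists>h. increasing_line X (line_less b) h \<and> x \<in> range h \<and> y \<in> range h"
    using oriented_increasing[OF b m(1)] by (intro exI[of _ m]) simp
  have "x \<in> range m" "y \<in> range m" using m(2) by auto
  then obtain s t where e: "x = m s" "y = m t" by (elim rangeE)
  show "x = y \<or> (x, y) \<in> line_less b \<or> (y, x) \<in> line_less b"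
    unfolding e line_less_iff[OF b m(1)] by (cases s t rule: linorder_cases) auto
qed

theorem ex_ordered_curve: "\<exists>r. ordered_curve X r"
proof -
  have "topspace X \<noteq> {}"
    using noncompact unfolding seq_compactin_def by auto
  then show ?thesis using ex_line_through ordered_curve_line_less by blast
qed

end

lemma increasing_line_reflect:
  assumes "increasing_line X r h"
  shows "increasing_line X (r\<inverse>) (\<lambda>t. h (- t))"
  unfolding increasing_line_def
proof (intro conjI allI impI)
  have c: "continuous_map euclideanreal X h" using assms by (simp add: increasing_line_def)
  show "continuous_map euclideanreal X (\<lambda>t. h (- t))"
    using continuous_map_compose[of euclideanreal euclideanreal uminus X h] c
    by (simp add: o_def continuous_on_minus)
  show "openin X ((\<lambda>t. h (- t)) ` U)" if "open U" for U
  proof -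
    have "open (uminus ` U)" using that by (rule open_negations)
    then have "openin X (h ` uminus ` U)" using assms by (simp add: increasing_line_def)
    then show ?thesis by (simp only: image_image)
  qed
  show "(h (- s), h (- t)) \<in> r\<inverse> \<longleftrightarrow> s < t" for s t
    using assms by (simp add: increasing_line_def)
  show "y \<in> range (\<lambda>t. h (- t))" if "(h (- s), y) \<in> r\<inverse>" "(y, h (- t)) \<in> r\<inverse>" for s t y
  proof -
    have "y \<in> range h" using assms that unfolding increasing_line_def by blast
    then obtain u where "y = h u" by (elim rangeE)
    then have "y = h (- (- u))" by simp
    then show ?thesis by (rule range_eqI)
  qed
qed

section \<open>Intervals and suprema in the order\<close>

context ordered_curve
begin

abbreviation lt (infix \<open>\<sqsubset>\<close> 50) where "x \<sqsubset> y \<equiv> (x, y) \<in> r"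
abbreviation le (infix \<open>\<sqsubseteq>\<close> 50) where "x \<sqsubseteq> y \<equiv> (x, y) \<in> r \<or> x = y"

lemma asym: "x \<sqsubset> y \<Longrightarrow> \<not> y \<sqsubset> x"
  using irrefl trans by blast

lemma le_trans: "x \<sqsubseteq> y \<Longrightarrow> y \<sqsubseteq> z \<Longrightarrow> x \<sqsubseteq> z"
  using trans by blast

lemma le_lt_trans: "x \<sqsubseteq> y \<Longrightarrow> y \<sqsubset> z \<Longrightarrow> x \<sqsubset> z"
  using trans by blast

lemma lt_le_trans: "x \<sqsubset> y \<Longrightarrow> y \<sqsubseteq> z \<Longrightarrow> x \<sqsubset> z"
  using trans by blast

lemma not_lt: "x \<in> topspace X \<Longrightarrow> y \<in> topspace X \<Longrightarrow> \<not> x \<sqsubset> y \<longleftrightarrow> y \<sqsubseteq> x"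
  using total irrefl asym by blast

lemma converse_ordered_curve: "ordered_curve X (r\<inverse>)"
proof
  fix x y z
  show "x \<in> topspace X \<and> y \<in> topspace X" if "(x, y) \<in> r\<inverse>" using in_space that by blast
  show "(x, x) \<notin> r\<inverse>" using irrefl by blast
  show "(x, z) \<in> r\<inverse>" if "(x, y) \<in> r\<inverse>" "(y, z) \<in> r\<inverse>" using that trans by blast
  assume xy: "x \<in> topspace X" "y \<in> topspace X"
  then show "x = y \<or> (x, y) \<in> r\<inverse> \<or> (y, x) \<in> r\<inverse>" using total by blast
  obtain h where h: "increasing_line X r h" "x \<in> range h" "y \<in> range h"
    using ex_increasing_line[OF xy] by blast
  then obtain s t where "x = h (- (- s))" "y = h (- (- t))" by auto
  then have "x \<in> range (\<lambda>t. h (- t))" "y \<in> range (\<lambda>t. h (- t))" by blast+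
  then show "\<exists>h. increasing_line X (r\<inverse>) h \<and> x \<in> range h \<and> y \<in> range h"
    using increasing_line_reflect[OF h(1)] by (intro exI conjI)
qed

lemma increasing_line_less: "increasing_line X r h \<Longrightarrow> h s \<sqsubset> h t \<longleftrightarrow> s < t"
  by (simp add: increasing_line_def)

lemma increasing_line_eq:
  assumes "increasing_line X r h"
  shows "h s = h t \<longleftrightarrow> s = t"
proof
  assume "h s = h t"
  then have "\<not> h s \<sqsubset> h t" "\<not> h t \<sqsubset> h s" using irrefl by simp_all
  then show "s = t" using increasing_line_less[OF assms] by simp
qed simp

lemma increasing_line_le:
  assumes "increasing_line X r h"
  shows "h s \<sqsubseteq> h t \<longleftrightarrow> s \<le> t"
  using increasing_line_less[OF assms] increasing_line_eq[OF assms] by auto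

lemma increasing_line_convex:
  assumes h: "increasing_line X r h" and "h s \<sqsubseteq> y" "y \<sqsubseteq> h t"
  obtains u where "y = h u" "s \<le> u" "u \<le> t"
proof -
  have "y \<in> range h" using assms unfolding increasing_line_def by blast
  then obtain u where u: "y = h u" by (elim rangeE)
  then show ?thesis using that assms increasing_line_le[OF h] by blast
qed

lemma increasing_line_in: "increasing_line X r h \<Longrightarrow> h t \<in> topspace X"
  unfolding increasing_line_def by (auto simp: continuous_map_def)

lemma increasing_line_through:
  assumes "x \<in> topspace X" "y \<in> topspace X"
  obtains h s t where "increasing_line X r h" "x = h s" "y = h t"
  using ex_increasing_line[OF assms] by (elim exE conjE rangeE)

lemma no_greatest:
  assumes "x \<in> topspace X"
  obtains y where "y \<in> topspace X" "x \<sqsubset> y"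
proof -
  obtain h s t where h: "increasing_line X r h" "x = h s" "x = h t"
    using increasing_line_through[OF assms assms] .
  then have "x \<sqsubset> h (s + 1)" by (simp add: increasing_line_less)
  then show ?thesis using that in_space by blast
qed

lemma seq_compactin_interval:
  assumes "x \<in> topspace X" "y \<in> topspace X" "x \<sqsubseteq> y"
  shows "seq_compactin X {z. x \<sqsubseteq> z \<and> z \<sqsubseteq> y}"
proof -
  obtain h s t where h: "increasing_line X r h" "x = h s" "y = h t"
    using increasing_line_through[OF assms(1,2)] .
  have "{z. x \<sqsubseteq> z \<and> z \<sqsubseteq> y} = h ` {s..t}"
  proof (intro equalityI subsetI)
    fix z assume "z \<in> {z. x \<sqsubseteq> z \<and> z \<sqsubseteq> y}"
    then have "h s \<sqsubseteq> z" "z \<sqsubseteq> h t" unfolding h by simp_all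
    then obtain u where "z = h u" "s \<le> u" "u \<le> t" using increasing_line_convex[OF h(1)] by blast
    then show "z \<in> h ` {s..t}" by simp
  next
    fix z assume "z \<in> h ` {s..t}"
    then obtain u where "z = h u" "s \<le> u" "u \<le> t" by auto
    then show "z \<in> {z. x \<sqsubseteq> z \<and> z \<sqsubseteq> y}"
      using increasing_line_le[OF h(1), of s u] increasing_line_le[OF h(1), of u t] by (simp add: h)
  qed
  moreover have "continuous_map (top_of_set {s..t}) X h"
    using h(1) by (simp add: increasing_line_def continuous_map_from_subtopology)
  ultimately show ?thesis using seq_compactin_continuous_image[of "{s..t}"] by simp
qed

text \<open>On a line through \<open>a\<close> and the upper bound \<open>y\<close>, convexity makes
  the part of \<open>A\<close> from \<open>a\<close> on a bounded set of parameters, whose real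
  supremum gives the least upper bound.\<close>

lemma ex_lub:
  assumes A: "A \<subseteq> topspace X" "a \<in> A" and y: "y \<in> topspace X" "\<And>x. x \<in> A \<Longrightarrow> x \<sqsubseteq> y"
  shows "\<exists>l\<in>topspace X. (\<forall>x\<in>A. x \<sqsubseteq> l) \<and> (\<forall>u\<in>topspace X. (\<forall>x\<in>A. x \<sqsubseteq> u) \<longrightarrow> l \<sqsubseteq> u)"
proof -
  have aX: "a \<in> topspace X" using A by blast
  obtain h s t where h: "increasing_line X r h" "a = h s" "y = h t"
    using increasing_line_through[OF aX y(1)] .
  define T where "T = {v. h v \<in> A}"
  have sT: "s \<in> T" using A(2) h(2) by (simp add: T_def)
  have T_le: "v \<le> t" if "v \<in> T" for v
    using y(2)[of "h v"] that increasing_line_le[OF h(1), of v t] by (simp add: T_def h(3))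
  then have bdd: "bdd_above T" by (rule bdd_aboveI)
  have sS: "s \<le> Sup T" using cSup_upper[OF sT bdd] .
  have "x \<sqsubseteq> h (Sup T)" if x: "x \<in> A" for x
  proof (cases "x \<sqsubseteq> a")
    case True
    moreover have "a \<sqsubseteq> h (Sup T)" unfolding h(2) using sS increasing_line_le[OF h(1)] by blast
    ultimately show ?thesis by (rule le_trans)
  next
    case False
    then have "h s \<sqsubseteq> x" using total[OF aX, of x] x A unfolding h(2) by blast
    moreover have "x \<sqsubseteq> h t" using y(2)[OF x] unfolding h(3) .
    ultimately obtain v where v: "x = h v" using increasing_line_convex[OF h(1)] by blast
    then have "v \<in> T" using x by (simp add: T_def)
    then have "v \<le> Sup T" using bdd by (rule cSup_upper)
    then show ?thesis unfolding v using increasing_line_le[OF h(1)] by blast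
  qed
  moreover have "h (Sup T) \<sqsubseteq> u" if u: "u \<in> topspace X" "\<forall>x\<in>A. x \<sqsubseteq> u" for u
  proof (rule ccontr)
    assume "\<not> h (Sup T) \<sqsubseteq> u"
    then have ul: "u \<sqsubset> h (Sup T)" using total[OF u(1) increasing_line_in[OF h(1), of "Sup T"]] by blast
    have "h s \<sqsubseteq> u" using u(2) A(2) h(2) by blast
    then obtain v where v: "u = h v" using ul increasing_line_convex[OF h(1)] by blast
    then have "v < Sup T" using ul increasing_line_less[OF h(1)] by simp
    then obtain w where "w \<in> T" "v < w" using less_cSup_iff[OF _ bdd] sT by blast
    then show False
      using u(2) increasing_line_le[OF h(1), of w v] unfolding T_def v by auto
  qed
  ultimately show ?thesis using increasing_line_in[OF h(1)] by blast
qed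

text \<open>An affine change of parameter moves the two points to 0 and 1. The interval covered is
  half-open because such pieces will tile the curve without overlap.\<close>

lemma ex_unit_parametrization:
  assumes "x \<sqsubset> y"
  obtains e :: "real \<Rightarrow> 'a" where
    "\<And>s t. e s \<sqsubset> e t \<longleftrightarrow> s < t" "e 0 = x" "e 1 = y" "\<And>t. e t \<in> topspace X"
    "\<And>z. x \<sqsubseteq> z \<Longrightarrow> z \<sqsubset> y \<Longrightarrow> \<exists>t. 0 \<le> t \<and> t < 1 \<and> z = e t"
proof -
  have "x \<in> topspace X" "y \<in> topspace X" using in_space[OF assms] by auto
  then obtain h a b where h: "increasing_line X r h" "x = h a" "y = h b"
    by (rule increasing_line_through)
  have ab: "a < b" using assms increasing_line_less[OF h(1)] unfolding h by blast
  define e where "e = (\<lambda>t. h (a + t * (b - a)))"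
  have le: "e s \<sqsubset> e t \<longleftrightarrow> s < t" for s t
    unfolding e_def increasing_line_less[OF h(1)] using ab by simp
  show ?thesis
  proof (rule that[of e])
    show "e s \<sqsubset> e t \<longleftrightarrow> s < t" for s t by (rule le)
    show "e 0 = x" "e 1 = y" by (simp_all add: e_def h)
    show "e t \<in> topspace X" for t unfolding e_def by (rule increasing_line_in[OF h(1)])
    fix z assume z: "x \<sqsubseteq> z" "z \<sqsubset> y"
    then have "h a \<sqsubseteq> z" "z \<sqsubseteq> h b" unfolding h by blast+
    then obtain u where u: "z = h u" "a \<le> u" using increasing_line_convex[OF h(1)] by blast
    have "u < b" using z(2) unfolding u h increasing_line_less[OF h(1)] .
    then have "0 \<le> (u - a) / (b - a)" "(u - a) / (b - a) < 1" "z = e ((u - a) / (b - a))"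
      using u ab by (simp_all add: e_def)
    then show "\<exists>t. 0 \<le> t \<and> t < 1 \<and> z = e t" by blast
  qed
qed

end

section \<open>Order topologies\<close>

lemma topspace_order_topology [simp]: "topspace (order_topology C r) = C"
  unfolding order_topology_def topology_generated_by_topspace by auto

lemma openin_below: "a \<in> C \<Longrightarrow> openin (order_topology C r) {x \<in> C. (x, a) \<in> r}"
  unfolding order_topology_def by (rule topology_generated_by_Basis) auto

lemma openin_above: "a \<in> C \<Longrightarrow> openin (order_topology C r) {x \<in> C. (a, x) \<in> r}"
  unfolding order_topology_def by (rule topology_generated_by_Basis) auto

lemma continuous_map_order_topology:
  assumes "f \<in> topspace T \<rightarrow> C"
    and "\<And>a. a \<in> C \<Longrightarrow> openin T {x \<in> topspace T. (f x, a) \<in> r}"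
    and "\<And>a. a \<in> C \<Longrightarrow> openin T {x \<in> topspace T. (a, f x) \<in> r}"
  shows "continuous_map T (order_topology C r) f"
  unfolding order_topology_def
proof (rule continuous_on_generated_topo)
  fix U assume "U \<in> insert C ((\<lambda>a. {x \<in> C. (x, a) \<in> r}) ` C \<union> (\<lambda>a. {x \<in> C. (a, x) \<in> r}) ` C)"
  then consider "U = C" | a where "a \<in> C" "U = {x \<in> C. (x, a) \<in> r}" | a where "a \<in> C" "U = {x \<in> C. (a, x) \<in> r}"
    by auto
  then show "openin T (f -` U \<inter> topspace T)"
  proof cases
    case 1
    then have "f -` U \<inter> topspace T = topspace T" using assms(1) by auto
    then show ?thesis by simp
  next
    case 2
    then have "f -` U \<inter> topspace T = {x \<in> topspace T. (f x, a) \<in> r}" using assms(1) by auto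
    then show ?thesis using assms(2)[OF 2(1)] by simp
  next
    case 3
    then have "f -` U \<inter> topspace T = {x \<in> topspace T. (a, f x) \<in> r}" using assms(1) by auto
    then show ?thesis using assms(3)[OF 3(1)] by simp
  qed
qed (use assms(1) in auto)

definition order_iso_on :: "'a set \<Rightarrow> 'a rel \<Rightarrow> 'b set \<Rightarrow> 'b rel \<Rightarrow> ('a \<Rightarrow> 'b) \<Rightarrow> bool" where
  "order_iso_on C q S r F \<longleftrightarrow>
     bij_betw F C S \<and> (\<forall>x\<in>C. \<forall>y\<in>C. (x, y) \<in> q \<longleftrightarrow> (F x, F y) \<in> r)"

lemma order_iso_on_inv:
  assumes "order_iso_on C q S r F"
  shows "order_iso_on S r C q (inv_into C F)"
proof -
  have b: "bij_betw F C S" using assms by (simp add: order_iso_on_def)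
  have "inv_into C F x \<in> C" "F (inv_into C F x) = x" if "x \<in> S" for x
    using that b by (auto simp: bij_betw_def inv_into_into f_inv_into_f)
  then show ?thesis
    using assms bij_betw_inv_into[OF b] unfolding order_iso_on_def by auto
qed

lemma order_iso_on_continuous:
  assumes "order_iso_on C q S r F"
  shows "continuous_map (order_topology C q) (order_topology S r) F"
proof (rule continuous_map_order_topology)
  have b: "bij_betw F C S" and F: "\<And>x y. x \<in> C \<Longrightarrow> y \<in> C \<Longrightarrow> (x, y) \<in> q \<longleftrightarrow> (F x, F y) \<in> r"
    using assms by (simp_all add: order_iso_on_def)
  show "F \<in> topspace (order_topology C q) \<rightarrow> S" using b by (auto simp: bij_betw_def)
  fix a assume "a \<in> S"
  then obtain c where c: "c \<in> C" "a = F c" using b by (auto simp: bij_betw_def)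
  have "{x \<in> topspace (order_topology C q). (F x, a) \<in> r} = {x \<in> C. (x, c) \<in> q}"
    "{x \<in> topspace (order_topology C q). (a, F x) \<in> r} = {x \<in> C. (c, x) \<in> q}"
    using c F by auto
  then show "openin (order_topology C q) {x \<in> topspace (order_topology C q). (F x, a) \<in> r}"
    "openin (order_topology C q) {x \<in> topspace (order_topology C q). (a, F x) \<in> r}"
    using openin_below[OF c(1)] openin_above[OF c(1)] by simp_all
qed

lemma order_iso_on_homeomorphic_space:
  assumes "order_iso_on C q S r F"
  shows "order_topology C q homeomorphic_space order_topology S r"
  unfolding homeomorphic_space_def homeomorphic_maps_def
proof (intro exI conjI)
  show "continuous_map (order_topology C q) (order_topology S r) F"
    by (rule order_iso_on_continuous[OF assms])
  show "continuous_map (order_topology S r) (order_topology C q) (inv_into C F)"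
    by (rule order_iso_on_continuous[OF order_iso_on_inv[OF assms]])
  show "\<forall>x\<in>topspace (order_topology C q). inv_into C F (F x) = x"
    "\<forall>y\<in>topspace (order_topology S r). F (inv_into C F y) = y"
    using assms by (auto simp: order_iso_on_def bij_betw_def f_inv_into_f)
qed

text \<open>Between strict linear orders a strictly monotone map is injective and reflects the
  order, so only monotonicity and the image have to be checked.\<close>

lemma (in ordered_curve) order_iso_onI:
  assumes F: "F ` C = S" "S \<subseteq> topspace X"
    and mono: "\<And>x y. x \<in> C \<Longrightarrow> y \<in> C \<Longrightarrow> (x, y) \<in> q \<Longrightarrow> (F x, F y) \<in> r"
    and tot: "\<And>x y. x \<in> C \<Longrightarrow> y \<in> C \<Longrightarrow> x = y \<or> (x, y) \<in> q \<or> (y, x) \<in> q"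
  shows "order_iso_on C q S r F"
  unfolding order_iso_on_def bij_betw_def
proof (intro conjI ballI iffI)
  show "inj_on F C"
  proof (rule inj_onI)
    fix x y assume *: "x \<in> C" "y \<in> C" "F x = F y"
    then show "x = y" using tot[OF *(1,2)] mono[of x y] mono[of y x] irrefl[of "F x"] by auto
  qed
  fix x y assume *: "x \<in> C" "y \<in> C" "F x \<sqsubset> F y"
  then show "(x, y) \<in> q" using tot[OF *(1,2)] mono[of y x] asym irrefl by metis
qed (use assms in auto)

context ordered_curve
begin

text \<open>Rays are open since lines are open maps. Conversely, a neighbourhood of \<open>y\<close>
  contains the image of a small parameter interval, which by convexity is an interval of the order.
  This reduces homeomorphisms to order isomorphisms.\<close>

lemma topology_eq: "X = order_topology (topspace X) r"
proof -
  have 1: "openin X {x \<in> topspace X. x \<sqsubset> a}" "openin X {x \<in> topspace X. a \<sqsubset> x}" if a: "a \<in> topspace X" for a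
  proof -
    show "openin X {x \<in> topspace X. x \<sqsubset> a}"
    proof (subst openin_subopen, intro ballI)
      fix y assume y: "y \<in> {x \<in> topspace X. x \<sqsubset> a}"
      then obtain h s t where h: "increasing_line X r h" "y = h s" "a = h t"
        using increasing_line_through[of y a] a by blast
      have "openin X (h ` {..<t})" using h(1) by (simp add: increasing_line_def)
      moreover have "y \<in> h ` {..<t}" using y h increasing_line_less[OF h(1)] by auto
      moreover have "h ` {..<t} \<subseteq> {x \<in> topspace X. x \<sqsubset> a}"
        using increasing_line_less[OF h(1)] increasing_line_in[OF h(1)] h(3) by auto
      ultimately show "\<exists>T. openin X T \<and> y \<in> T \<and> T \<subseteq> {x \<in> topspace X. x \<sqsubset> a}" by blast
    qed
    show "openin X {x \<in> topspace X. a \<sqsubset> x}"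
    proof (subst openin_subopen, intro ballI)
      fix y assume y: "y \<in> {x \<in> topspace X. a \<sqsubset> x}"
      then obtain h s t where h: "increasing_line X r h" "y = h s" "a = h t"
        using increasing_line_through[of y a] a by blast
      have "openin X (h ` {t<..})" using h(1) by (simp add: increasing_line_def)
      moreover have "y \<in> h ` {t<..}" using y h increasing_line_less[OF h(1)] by auto
      moreover have "h ` {t<..} \<subseteq> {x \<in> topspace X. a \<sqsubset> x}"
        using increasing_line_less[OF h(1)] increasing_line_in[OF h(1)] h(3) by auto
      ultimately show "\<exists>T. openin X T \<and> y \<in> T \<and> T \<subseteq> {x \<in> topspace X. a \<sqsubset> x}" by blast
    qed
  qed
  have "continuous_map X (order_topology (topspace X) r) (\<lambda>x. x)"
    by (rule continuous_map_order_topology) (use 1 in auto)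
  then have le: "openin X U" if "openin (order_topology (topspace X) r) U" for U
  proof -
    have "{x \<in> topspace X. x \<in> U} = U" using openin_subset[OF that] by auto
    then show ?thesis
      using openin_continuous_map_preimage[OF \<open>continuous_map X _ _\<close> that] by simp
  qed
  have "openin (order_topology (topspace X) r) U" if U: "openin X U" for U
  proof (subst openin_subopen, intro ballI)
    fix y assume y: "y \<in> U"
    then have yX: "y \<in> topspace X" using openin_subset[OF U] by blast
    obtain h s s' where h: "increasing_line X r h" "y = h s" "y = h s'"
      using increasing_line_through[OF yX yX] .
    have "open {t. h t \<in> U}"
      using openin_continuous_map_preimage[OF _ U, of euclideanreal h] h(1)
      by (simp add: increasing_line_def)
    moreover have "s \<in> {t. h t \<in> U}" using y h(2) by simp
    ultimately obtain e where e: "e > 0" "cball s e \<subseteq> {t. h t \<in> U}"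
      using open_contains_cball by blast
    define V where "V = {x \<in> topspace X. h (s - e) \<sqsubset> x} \<inter> {x \<in> topspace X. x \<sqsubset> h (s + e)}"
    have "openin (order_topology (topspace X) r) V"
      unfolding V_def using increasing_line_in[OF h(1)] by (intro openin_Int openin_below openin_above)
    moreover have "y \<in> V"
      unfolding V_def h(2) using e(1) increasing_line_less[OF h(1)] increasing_line_in[OF h(1)] by simp
    moreover have "V \<subseteq> U"
    proof
      fix z assume "z \<in> V"
      then have "h (s - e) \<sqsubseteq> z" "z \<sqsubseteq> h (s + e)" unfolding V_def by blast+
      then obtain u where u: "z = h u" "s - e \<le> u" "u \<le> s + e"
        using increasing_line_convex[OF h(1)] by blast
      then have "u \<in> cball s e" by (simp add: dist_real_def abs_le_iff)
      then show "z \<in> U" using e(2) u(1) by blast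
    qed
    ultimately show "\<exists>T. openin (order_topology (topspace X) r) T \<and> y \<in> T \<and> T \<subseteq> U" by blast
  qed
  with le show ?thesis unfolding topology_eq by blast
qed

end

text \<open>With this instance \<open>topology_eq\<close> identifies the usual topology of the reals
  with an \<open>order_topology\<close>.\<close>

lemma ordered_curve_real: "ordered_curve euclideanreal {(s, t). s < t}"
proof
  fix x y :: real
  have "increasing_line euclideanreal {(s::real, t). s < t} (\<lambda>t. t)"
    unfolding increasing_line_def by auto
  then show "\<exists>h. increasing_line euclideanreal {(s, t). s < t} h \<and> x \<in> range h \<and> y \<in> range h"
    by (intro exI[of _ "\<lambda>t. t"]) simp
qed auto

lemma euclideanreal_eq_order_topology: "euclideanreal = order_topology UNIV {(s, t). s < t}"
  using ordered_curve.topology_eq[OF ordered_curve_real] by simp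

section \<open>Order isomorphisms with the real line\<close>

context ordered_curve
begin

text \<open>Each step goes above the preceding term and above the next member of an enumeration of
  the countable cofinal set, which makes the sequence cofinal too.\<close>

lemma ex_increasing_sequence:
  assumes S: "S \<subseteq> topspace X" "a \<in> S" and nomax: "\<And>x. x \<in> S \<Longrightarrow> \<exists>y\<in>S. x \<sqsubset> y"
    and D: "countable D" "D \<subseteq> S" "\<And>x. x \<in> S \<Longrightarrow> \<exists>d\<in>D. x \<sqsubseteq> d"
  obtains u :: "nat \<Rightarrow> 'a" where "u 0 = a" "\<And>n. u n \<in> S" "\<And>n. u n \<sqsubset> u (Suc n)"
    "\<And>x. x \<in> S \<Longrightarrow> \<exists>n. x \<sqsubset> u n"
proof -
  have "D \<noteq> {}" using D(3)[OF S(2)] by blast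
  then obtain d :: "nat \<Rightarrow> 'a" where d: "range d = D" using D(1) uncountable_def by metis
  have step: "\<exists>y. y \<in> S \<and> x \<sqsubset> y \<and> d n \<sqsubset> y" if x: "x \<in> S" for x n
  proof -
    have dn: "d n \<in> S" using d D(2) by blast
    have "x \<sqsubseteq> d n \<or> d n \<sqsubseteq> x" using total[of x "d n"] x dn S(1) by blast
    then obtain z where z: "z \<in> S" "x \<sqsubseteq> z" "d n \<sqsubseteq> z" using x dn by blast
    obtain y where "y \<in> S" "z \<sqsubset> y" using nomax[OF z(1)] by blast
    then show ?thesis using z le_lt_trans by blast
  qed
  obtain u where u: "u 0 = a" "\<And>n. u n \<in> S" "\<And>n. u n \<sqsubset> u (Suc n) \<and> d n \<sqsubset> u (Suc n)"
    using dependent_nat_choice[of "\<lambda>n x. x \<in> S \<and> (n = 0 \<longrightarrow> x = a)" "\<lambda>n x y. x \<sqsubset> y \<and> d n \<sqsubset> y"]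
      step S(2) by (metis nat.distinct(1))
  have "\<exists>n. x \<sqsubset> u n" if "x \<in> S" for x
  proof -
    obtain n where "x \<sqsubseteq> d n" using D(3)[OF \<open>x \<in> S\<close>] d by blast
    then show ?thesis using u(3)[of n] le_lt_trans by blast
  qed
  then show ?thesis using that u by blast
qed

text \<open>Between consecutive points of \<open>c\<close> the set is a copy of the half-open unit
  interval; the integer part of a real number selects the piece and the fractional part the position
  in it.\<close>

lemma real_order_iso:
  fixes c :: "int \<Rightarrow> 'a"
  assumes S: "S \<subseteq> topspace X" and conv: "\<And>x y z. x \<in> S \<Longrightarrow> y \<in> S \<Longrightarrow> x \<sqsubseteq> z \<Longrightarrow> z \<sqsubseteq> y \<Longrightarrow> z \<in> S"
    and c: "\<And>k. c k \<in> S" "\<And>k. c k \<sqsubset> c (k + 1)"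
    and cover: "\<And>x. x \<in> S \<Longrightarrow> \<exists>k. c k \<sqsubseteq> x \<and> x \<sqsubset> c (k + 1)"
  shows "\<exists>F. order_iso_on UNIV {(s::real, t). s < t} S r F"
proof -
  have "\<exists>e. (\<forall>s t. e s \<sqsubset> e t \<longleftrightarrow> s < t) \<and> e (0::real) = c k \<and> e 1 = c (k + 1) \<and>
      (\<forall>z. c k \<sqsubseteq> z \<longrightarrow> z \<sqsubset> c (k + 1) \<longrightarrow> (\<exists>t. 0 \<le> t \<and> t < 1 \<and> z = e t))" for k
    using ex_unit_parametrization[OF c(2)[of k]] by metis
  then obtain e where e: "\<And>k s t. e k s \<sqsubset> e k t \<longleftrightarrow> s < t" "\<And>k. e k (0::real) = c k"
      "\<And>k. e k 1 = c (k + 1)"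
      "\<And>k z. c k \<sqsubseteq> z \<Longrightarrow> z \<sqsubset> c (k + 1) \<Longrightarrow> \<exists>t. 0 \<le> t \<and> t < 1 \<and> z = e k t"
    by metis
  have c_add: "c i \<sqsubseteq> c (i + int n)" for i n
  proof (induction n)
    case (Suc n)
    have "i + int (Suc n) = (i + int n) + 1" by simp
    then show ?case using Suc.IH c(2)[of "i + int n"] by (metis trans)
  qed simp
  have c_mono: "c i \<sqsubseteq> c j" if "i \<le> j" for i j
    using c_add[of i "nat (j - i)"] that by simp
  have e_ge: "c k \<sqsubseteq> e k t" if "0 \<le> t" for k t
    using that e(1)[of k 0 t] unfolding e(2) by (cases "t = 0") (simp_all add: e(2))
  have e_lt: "e k t \<sqsubset> c (k + 1)" if "t < 1" for k t
    using that e(1)[of k t 1] unfolding e(3) by simp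
  define F where "F = (\<lambda>t. e \<lfloor>t\<rfloor> (frac t))"
  have "order_iso_on UNIV {(s, t). s < t} S r F"
  proof (rule order_iso_onI)
    show "S \<subseteq> topspace X" by (rule S)
    show "F ` UNIV = S"
    proof (intro equalityI subsetI)
      fix x assume "x \<in> F ` UNIV"
      then obtain t where "x = e \<lfloor>t\<rfloor> (frac t)" unfolding F_def by blast
      then have "c \<lfloor>t\<rfloor> \<sqsubseteq> x" "x \<sqsubset> c (\<lfloor>t\<rfloor> + 1)" using e_ge e_lt frac_ge_0 frac_lt_1 by metis+
      then show "x \<in> S" using conv[OF c(1) c(1)] by blast
    next
      fix x assume "x \<in> S"
      then obtain k where k: "c k \<sqsubseteq> x" "x \<sqsubset> c (k + 1)" using cover by blast
      obtain t where t: "0 \<le> t" "t < 1" "x = e k t" using e(4)[OF k] by blast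
      have "\<lfloor>of_int k + t\<rfloor> = k" using t by (simp add: floor_unique)
      moreover from this have "frac (of_int k + t) = t" by (simp add: frac_def)
      ultimately have "F (of_int k + t) = x" unfolding F_def t(3) by simp
      then show "x \<in> F ` UNIV" by blast
    qed
    fix s t :: real assume "(s, t) \<in> {(s, t). s < t}"
    then have st: "s < t" by simp
    show "F s \<sqsubset> F t"
    proof (cases "\<lfloor>s\<rfloor> = \<lfloor>t\<rfloor>")
      case True
      then have "frac s < frac t" using st by (simp add: frac_def)
      then show ?thesis unfolding F_def True e(1) .
    next
      case False
      then have "\<lfloor>s\<rfloor> + 1 \<le> \<lfloor>t\<rfloor>" using floor_mono[of s t] st by linarith
      from c_mono[OF this] have "c (\<lfloor>s\<rfloor> + 1) \<sqsubseteq> e \<lfloor>t\<rfloor> (frac t)"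
        using e_ge[OF frac_ge_0] by (rule le_trans)
      with e_lt[OF frac_lt_1] show ?thesis unfolding F_def by (rule lt_le_trans)
    qed
  qed auto
  then show ?thesis by blast
qed

lemma real_order_iso_if_countable:
  assumes S: "S \<subseteq> topspace X" "a \<in> S"
    and conv: "\<And>x y z. x \<in> S \<Longrightarrow> y \<in> S \<Longrightarrow> x \<sqsubseteq> z \<Longrightarrow> z \<sqsubseteq> y \<Longrightarrow> z \<in> S"
    and nomax: "\<And>x. x \<in> S \<Longrightarrow> \<exists>y\<in>S. x \<sqsubset> y" and nomin: "\<And>x. x \<in> S \<Longrightarrow> \<exists>y\<in>S. y \<sqsubset> x"
    and D: "countable D" "D \<subseteq> S" "\<And>x. x \<in> S \<Longrightarrow> \<exists>d\<in>D. x \<sqsubseteq> d"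
    and E: "countable E" "E \<subseteq> S" "\<And>x. x \<in> S \<Longrightarrow> \<exists>d\<in>E. d \<sqsubseteq> x"
  shows "\<exists>F. order_iso_on UNIV {(s::real, t). s < t} S r F"
proof -
  obtain u where u: "u 0 = a" "\<And>n. u n \<in> S" "\<And>n. u n \<sqsubset> u (Suc n)" "\<And>x. x \<in> S \<Longrightarrow> \<exists>n. x \<sqsubset> u n"
    using ex_increasing_sequence[OF S nomax D] by metis
  obtain v where v: "v 0 = a" "\<And>n. v n \<in> S" "\<And>n. v (Suc n) \<sqsubset> v n" "\<And>x. x \<in> S \<Longrightarrow> \<exists>n. v n \<sqsubset> x"
  proof (rule ordered_curve.ex_increasing_sequence[OF converse_ordered_curve S _ E(1,2)])
    show "\<exists>y\<in>S. (x, y) \<in> r\<inverse>" if "x \<in> S" for x using nomin[OF that] by simp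
    show "\<exists>d\<in>E. (x, d) \<in> r\<inverse> \<or> x = d" if "x \<in> S" for x using E(3)[OF that] by auto
  qed (auto intro: that)
  \<comment> \<open>Both sequences start at \<open>a\<close>, so they fit together at index
    0.\<close>
  define c where "c = (\<lambda>k. if 0 \<le> k then u (nat k) else v (nat (- k)))"
  have cu: "c (int n) = u n" for n by (simp add: c_def)
  have cv: "c (- int n) = v n" for n using u(1) v(1) by (cases n) (simp_all add: c_def del: of_nat_Suc)
  have cv': "c (1 - int (Suc n)) = v n" for n using cv[of n] by simp
  show ?thesis
  proof (rule real_order_iso[OF S(1)])
    show "z \<in> S" if "x \<in> S" "y \<in> S" "x \<sqsubseteq> z" "z \<sqsubseteq> y" for x y z using conv[OF that] .
    show "c k \<in> S" for k using u(2) v(2) by (simp add: c_def)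
    show "c k \<sqsubset> c (k + 1)" for k
    proof (cases "0 \<le> k")
      case True
      then obtain n where "k = int n" using nonneg_int_cases by blast
      then show ?thesis using u(3)[of n] cu[of n] cu[of "Suc n"] by (simp add: add.commute)
    next
      case False
      then obtain n where "k = - int (Suc n)" by (metis int_cases negD not_le)
      then show ?thesis using v(3)[of n] cv[of "Suc n"] cv'[of n] by simp
    qed
    fix x assume x: "x \<in> S"
    show "\<exists>k. c k \<sqsubseteq> x \<and> x \<sqsubset> c (k + 1)"
    proof (cases "a \<sqsubseteq> x")
      case True
      \<comment> \<open>The first term beyond \<open>x\<close> is not \<open>u 0\<close>, so it has
        a predecessor, and these two bound the piece that contains \<open>x\<close>.\<close>
      define n where "n = (LEAST n. x \<sqsubset> u n)"
      have n: "x \<sqsubset> u n" unfolding n_def using u(4)[OF x] by (rule LeastI_ex)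
      have "n \<noteq> 0" using n True u(1) asym irrefl by metis
      then obtain m where m: "n = Suc m" using not0_implies_Suc by blast
      have "\<not> x \<sqsubset> u m" unfolding n_def using not_less_Least[of m "\<lambda>n. x \<sqsubset> u n"] m n_def by simp
      then have "u m \<sqsubseteq> x" using not_lt[of x "u m"] x u(2) S(1) by blast
      then have "c (int m) \<sqsubseteq> x \<and> x \<sqsubset> c (int m + 1)"
        using n cu[of m] cu[of "Suc m"] m by (simp add: add.commute)
      then show ?thesis by blast
    next
      case False
      have ex: "\<exists>n. v n \<sqsubseteq> x" using v(4)[OF x] by blast
      \<comment> \<open>Pieces contain their lower end, so here the least index is taken for the
        weak inequality.\<close>
      define n where "n = (LEAST n. v n \<sqsubseteq> x)"
      have n: "v n \<sqsubseteq> x" unfolding n_def using ex by (rule LeastI_ex)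
      have "n \<noteq> 0" using n False v(1) by metis
      then obtain m where m: "n = Suc m" using not0_implies_Suc by blast
      have "\<not> v m \<sqsubseteq> x" using not_less_Least[of m "\<lambda>n. v n \<sqsubseteq> x"] m n_def by simp
      then have "x \<sqsubset> v m" using total[of x "v m"] x v(2) S(1) by blast
      then have "c (- int n) \<sqsubseteq> x \<and> x \<sqsubset> c (- int n + 1)"
        using n cv[of n] cv'[of m] m by simp
      then show ?thesis by blast
    qed
  qed
qed

definition countable_coinitial :: bool where
  "countable_coinitial \<longleftrightarrow> (\<exists>D. countable D \<and> D \<subseteq> topspace X \<and> (\<forall>x\<in>topspace X. \<exists>d\<in>D. d \<sqsubseteq> x))"

definition countable_cofinal :: bool where
  "countable_cofinal \<longleftrightarrow> (\<exists>D. countable D \<and> D \<subseteq> topspace X \<and> (\<forall>x\<in>topspace X. \<exists>d\<in>D. x \<sqsubseteq> d))"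

lemma no_least:
  assumes "x \<in> topspace X"
  obtains y where "y \<in> topspace X" "y \<sqsubset> x"
  using ordered_curve.no_greatest[OF converse_ordered_curve assms] by blast

lemma homeomorphic_real:
  assumes "topspace X \<noteq> {}" countable_coinitial countable_cofinal
  shows "X homeomorphic_space euclideanreal"
proof -
  obtain a where a: "a \<in> topspace X" using assms by blast
  obtain D where D: "countable D" "D \<subseteq> topspace X" "\<And>x. x \<in> topspace X \<Longrightarrow> \<exists>d\<in>D. x \<sqsubseteq> d"
    using assms(3) unfolding countable_cofinal_def by blast
  obtain E where E: "countable E" "E \<subseteq> topspace X" "\<And>x. x \<in> topspace X \<Longrightarrow> \<exists>d\<in>E. d \<sqsubseteq> x"
    using assms(2) unfolding countable_coinitial_def by blast
  have "\<exists>F. order_iso_on UNIV {(s::real, t). s < t} (topspace X) r F"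
  proof (rule real_order_iso_if_countable[OF subset_refl a _ _ _ D E])
    show "z \<in> topspace X" if "x \<in> topspace X" "y \<in> topspace X" "x \<sqsubseteq> z" "z \<sqsubseteq> y" for x y z
      using that in_space by blast
    show "\<exists>y\<in>topspace X. x \<sqsubset> y" if "x \<in> topspace X" for x using no_greatest[OF that] by blast
    show "\<exists>y\<in>topspace X. y \<sqsubset> x" if "x \<in> topspace X" for x using no_least[OF that] by blast
  qed
  then obtain F where "order_iso_on UNIV {(s::real, t). s < t} (topspace X) r F" by blast
  from order_iso_on_homeomorphic_space[OF this] show ?thesis
    unfolding topology_eq[symmetric] euclideanreal_eq_order_topology[symmetric]
    by (rule homeomorphic_space_sym[THEN iffD1])
qed

text \<open>Downwards a countable coinitial set is given; upwards the rational parameters of a line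
  through \<open>b\<close> approach \<open>b\<close>. The set will fill the least piece of the long
  ray, which lacks its initial point.\<close>

lemma below_order_iso:
  assumes b: "b \<in> topspace X" and ci: countable_coinitial
  shows "\<exists>F. order_iso_on UNIV {(s::real, t). s < t} {x \<in> topspace X. x \<sqsubset> b} r F"
proof -
  let ?S = "{x \<in> topspace X. x \<sqsubset> b}"
  obtain E where E: "countable E" "E \<subseteq> topspace X" "\<And>x. x \<in> topspace X \<Longrightarrow> \<exists>d\<in>E. d \<sqsubseteq> x"
    using ci unfolding countable_coinitial_def by blast
  obtain h t t' where h: "increasing_line X r h" "b = h t" "b = h t'"
    using increasing_line_through[OF b b] .
  have less: "h q \<sqsubset> b \<longleftrightarrow> q < t" for q unfolding h(2) by (rule increasing_line_less[OF h(1)])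
  define D where "D = h ` (\<rat> \<inter> {..<t})"
  have above: "\<exists>d\<in>D. x \<sqsubset> d" if x: "x \<in> ?S" for x
  proof (cases "\<exists>q\<in>\<rat>. q < t \<and> x \<sqsubset> h q")
    case True
    then show ?thesis unfolding D_def by blast
  next
    case False
    obtain q where q: "q \<in> \<rat>" "q < t" using Rats_dense_in_real[of "t - 1" t] by auto
    then have "h q \<sqsubseteq> x" using False total[of x "h q"] x increasing_line_in[OF h(1)] by blast
    moreover have "x \<sqsubseteq> h t" using x h(2) by blast
    ultimately obtain u where u: "x = h u" using increasing_line_convex[OF h(1)] by blast
    then have "u < t" using x less by simp
    then obtain q' where "q' \<in> \<rat>" "u < q'" "q' < t" using Rats_dense_in_real by blast
    then show ?thesis using False u increasing_line_less[OF h(1)] by blast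
  qed
  have S_down: "x \<in> ?S" if "x \<sqsubseteq> y" "y \<in> ?S" for x y using that in_space trans by blast
  obtain a where a: "a \<in> ?S" using no_least[OF b] by blast
  show ?thesis
  proof (rule real_order_iso_if_countable[of ?S a D "E \<inter> ?S"])
    show "D \<subseteq> ?S" unfolding D_def using less increasing_line_in[OF h(1)] by auto
    then show "\<exists>y\<in>?S. x \<sqsubset> y" if "x \<in> ?S" for x using above[OF that] by blast
    show "\<exists>y\<in>?S. y \<sqsubset> x" if "x \<in> ?S" for x
      using no_least[of x] S_down[OF _ that] that by blast
    show "countable D" unfolding D_def using countable_rat by blast
    show "countable (E \<inter> ?S)" using E(1) by blast
    show "\<exists>d\<in>D. x \<sqsubseteq> d" if "x \<in> ?S" for x using above[OF that] by blast
    show "\<exists>d\<in>E \<inter> ?S. d \<sqsubseteq> x" if "x \<in> ?S" for x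
    proof -
      obtain d where "d \<in> E" "d \<sqsubseteq> x" using E(3)[of x] \<open>x \<in> ?S\<close> by blast
      then show ?thesis using S_down[OF _ \<open>x \<in> ?S\<close>] by blast
    qed
    show "z \<in> ?S" if "x \<in> ?S" "y \<in> ?S" "x \<sqsubseteq> z" "z \<sqsubseteq> y" for x y z
      using S_down[OF that(4,2)] .
  qed (use a in auto)
qed

section \<open>Long ends and sequential compactness\<close>

lemma countable_bounded:
  assumes "\<not> countable_cofinal" "countable A" "A \<subseteq> topspace X"
  obtains y where "y \<in> topspace X" "\<And>x. x \<in> A \<Longrightarrow> x \<sqsubset> y"
proof -
  have "\<not> (\<forall>y\<in>topspace X. \<exists>d\<in>A. y \<sqsubseteq> d)"
    using assms unfolding countable_cofinal_def by blast
  then obtain y where y: "y \<in> topspace X" "\<And>d. d \<in> A \<Longrightarrow> \<not> y \<sqsubseteq> d" by blast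
  show ?thesis
  proof (rule that[OF y(1)])
    fix x assume x: "x \<in> A"
    then have "x \<in> topspace X" using assms(3) by blast
    then show "x \<sqsubset> y" using y(2)[OF x] total[OF _ y(1), of x] by blast
  qed
qed

text \<open>The countably many terms of a sequence have a common upper bound \<open>y\<close>, and
  the closed interval from \<open>a\<close> to \<open>y\<close> is the image of a compact real
  interval.\<close>

lemma seq_compactin_above:
  assumes nc: "\<not> countable_cofinal" and a: "a \<in> topspace X"
  shows "seq_compactin X {x. a \<sqsubseteq> x}"
  unfolding seq_compactin_def
proof (intro conjI allI impI)
  show sub: "{x. a \<sqsubseteq> x} \<subseteq> topspace X" using a in_space by blast
  fix \<sigma> :: "nat \<Rightarrow> 'a"
  assume \<sigma>: "range \<sigma> \<subseteq> {x. a \<sqsubseteq> x}"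
  have "countable (range \<sigma>)" "range \<sigma> \<subseteq> topspace X" using \<sigma> sub by auto
  then obtain y where y: "y \<in> topspace X" "\<And>x. x \<in> range \<sigma> \<Longrightarrow> x \<sqsubset> y"
    using countable_bounded[OF nc] by blast
  then have ay: "a \<sqsubseteq> y" using \<sigma> trans by blast
  have "\<sigma> i \<in> {z. a \<sqsubseteq> z \<and> z \<sqsubseteq> y}" for i using y(2)[of "\<sigma> i"] \<sigma> by blast
  from seq_compactinD[OF seq_compactin_interval[OF a y(1) ay] this]
  obtain q p where "q \<in> {z. a \<sqsubseteq> z \<and> z \<sqsubseteq> y}" "strict_mono p" "limitin X (\<sigma> \<circ> p) q sequentially" .
  then show "\<exists>q\<in>{x. a \<sqsubseteq> x}. \<exists>p. strict_mono p \<and> limitin X (\<sigma> \<circ> p) q sequentially" by blast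
qed

text \<open>A sequence is now bounded below as well, which reduces the claim to a closed
  half-line.\<close>

lemma seq_compactin_topspace:
  assumes "\<not> countable_cofinal" "\<not> countable_coinitial"
  shows "seq_compactin X (topspace X)"
  unfolding seq_compactin_def
proof (intro conjI allI impI)
  fix \<sigma> :: "nat \<Rightarrow> 'a"
  assume \<sigma>: "range \<sigma> \<subseteq> topspace X"
  have c: "countable (range \<sigma>)" by simp
  have "\<not> (\<forall>x\<in>topspace X. \<exists>d\<in>range \<sigma>. d \<sqsubseteq> x)"
    using assms(2) c \<sigma> unfolding countable_coinitial_def by blast
  then obtain a where a: "a \<in> topspace X" "\<And>d. d \<in> range \<sigma> \<Longrightarrow> \<not> d \<sqsubseteq> a" by blast
  have "\<sigma> i \<in> {x. a \<sqsubseteq> x}" for i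
    using a(2)[of "\<sigma> i"] total[OF a(1), of "\<sigma> i"] \<sigma> by blast
  from seq_compactinD[OF seq_compactin_above[OF assms(1) a(1)] this]
  obtain q p where "q \<in> {x. a \<sqsubseteq> x}" "strict_mono p" "limitin X (\<sigma> \<circ> p) q sequentially" .
  then show "\<exists>q\<in>topspace X. \<exists>p. strict_mono p \<and> limitin X (\<sigma> \<circ> p) q sequentially"
    using a(1) in_space by blast
qed simp

text \<open>Countably many lines, joining the points of a countable coinitial set to
  \<open>a\<close>, cover everything below \<open>a\<close>, and their rational points are dense in
  them.\<close>

lemma ex_countable_dense_below:
  assumes ci: countable_coinitial and a: "a \<in> topspace X"
  obtains D where "countable D" "D \<subseteq> topspace X" "{x. x \<sqsubset> a} \<subseteq> X closure_of D"
proof -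
  obtain E where E: "countable E" "E \<subseteq> topspace X" "\<And>x. x \<in> topspace X \<Longrightarrow> \<exists>d\<in>E. d \<sqsubseteq> x"
    using ci unfolding countable_coinitial_def by blast
  have "\<forall>d\<in>E. \<exists>h. increasing_line X r h \<and> d \<in> range h \<and> a \<in> range h"
    using ex_increasing_line a E(2) by blast
  then obtain h where h: "\<And>d. d \<in> E \<Longrightarrow> increasing_line X r (h d)"
      "\<And>d. d \<in> E \<Longrightarrow> d \<in> range (h d)" "\<And>d. d \<in> E \<Longrightarrow> a \<in> range (h d)"
    by metis
  define D where "D = (\<Union>d\<in>E. h d ` \<rat>)"
  show ?thesis
  proof (rule that[of D])
    show "countable D" unfolding D_def using E(1) countable_rat by blast
    show "D \<subseteq> topspace X" unfolding D_def using increasing_line_in[OF h(1)] by blast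
    show "{x. x \<sqsubset> a} \<subseteq> X closure_of D"
    proof
      fix x assume "x \<in> {x. x \<sqsubset> a}"
      then have x: "x \<sqsubset> a" by simp
      obtain d where d: "d \<in> E" "d \<sqsubseteq> x" using E(3)[of x] in_space[OF x] by blast
      obtain s where s: "d = h d s" using h(2)[OF d(1)] by (elim rangeE)
      obtain t where t: "a = h d t" using h(3)[OF d(1)] by (elim rangeE)
      have "h d s \<sqsubseteq> x" using d(2) s by simp
      moreover have "x \<sqsubseteq> h d t" using x t by simp
      ultimately obtain u where u: "x = h d u" using increasing_line_convex[OF h(1)[OF d(1)]] by blast
      have "continuous_map euclideanreal X (h d)" using h(1)[OF d(1)] by (simp add: increasing_line_def)
      then have "h d ` (euclideanreal closure_of \<rat>) \<subseteq> X closure_of (h d ` \<rat>)"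
        by (rule continuous_map_image_closure_subset)
      moreover have "euclideanreal closure_of \<rat> = UNIV" by (simp add: Rats_closure_real)
      ultimately have "x \<in> X closure_of (h d ` \<rat>)" unfolding u by blast
      moreover have "h d ` \<rat> \<subseteq> D" unfolding D_def using d(1) by blast
      ultimately show "x \<in> X closure_of D" using closure_of_mono by blast
    qed
  qed
qed

end

section \<open>The long ray\<close>

unbundle cardinal_syntax

section \<open>The first uncountable ordinal\<close>

lemma Card_order_omega1: "Card_order omega1"
  unfolding omega1_def by (rule cardSuc_Card_order[OF natLeq_Card_order])

lemma linear_order_omega1: "Linear_order omega1" and wf_omega1: "wf (omega1 - Id)"
  using card_order_on_well_order_on[OF Card_order_omega1] by (simp_all add: well_order_on_def)

lemma omega1_minimal:
  assumes "P \<alpha>"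
  shows "\<exists>\<gamma>. P \<gamma> \<and> (\<forall>\<beta>. (\<beta>, \<gamma>) \<in> omega1 - Id \<longrightarrow> \<not> P \<beta>)"
proof -
  have "\<alpha> \<in> Collect P" using assms by simp
  then have "\<exists>z\<in>Collect P. \<forall>y. (y, z) \<in> omega1 - Id \<longrightarrow> y \<notin> Collect P"
    by (rule wf_omega1[unfolded wf_eq_minimal, THEN spec, THEN spec, THEN mp])
  then show ?thesis by (simp only: mem_Collect_eq Bex_def)
qed

lemma omega1_strict_total:
  assumes "x \<in> Field omega1" "y \<in> Field omega1"
  shows "x = y \<or> (x, y) \<in> omega1 - Id \<or> (y, x) \<in> omega1 - Id"
  using linear_order_omega1 assms by (auto simp: order_on_defs total_on_def)

lemma countable_iff_card_of_ordLeq_natLeq: "countable A \<longleftrightarrow> |A| \<le>o natLeq"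
proof -
  have "countable A \<longleftrightarrow> |A| \<le>o |UNIV :: nat set|"
    unfolding countable_def card_of_ordLeq[symmetric] by simp
  also have "\<dots> \<longleftrightarrow> |A| \<le>o natLeq"
    using card_of_nat ordIso_symmetric ordLeq_ordIso_trans by blast
  finally show ?thesis .
qed

text \<open>A proper initial segment of an initial ordinal has smaller cardinality, and below the
  successor cardinal of \<open>natLeq\<close> this means at most countable.\<close>

lemma countable_omega1_below:
  assumes "\<alpha> \<in> Field omega1"
  shows "countable {\<beta>. (\<beta>, \<alpha>) \<in> omega1 - Id}"
proof -
  have "|underS omega1 \<alpha>| <o omega1"
    by (rule card_of_underS[OF Card_order_omega1 assms])
  then have "|underS omega1 \<alpha>| \<le>o natLeq"
    unfolding omega1_def
    using cardSuc_ordLeq_ordLess[OF natLeq_Card_order card_of_Card_order] by blast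
  moreover have "{\<beta>. (\<beta>, \<alpha>) \<in> omega1 - Id} = underS omega1 \<alpha>" by (auto simp: underS_def)
  ultimately show ?thesis by (simp add: countable_iff_card_of_ordLeq_natLeq)
qed

lemma uncountable_omega1: "uncountable (Field omega1)"
proof
  assume "countable (Field omega1)"
  then have "|Field omega1| \<le>o natLeq" by (simp only: countable_iff_card_of_ordLeq_natLeq)
  moreover have "natLeq <o |Field omega1|"
    using cardSuc_greater[OF natLeq_Card_order] card_of_Field_ordIso[OF Card_order_omega1]
    unfolding omega1_def using ordIso_symmetric ordLess_ordIso_trans by blast
  ultimately show False using not_ordLess_ordLeq by blast
qed

lemma omega1_no_greatest:
  assumes "\<alpha> \<in> Field omega1"
  obtains \<beta> where "\<beta> \<in> Field omega1" "(\<alpha>, \<beta>) \<in> omega1 - Id"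
proof -
  have "infinite (Field omega1)" using uncountable_omega1 countable_finite by blast
  from infinite_Card_order_limit[OF Card_order_omega1 this assms] show ?thesis using that by blast
qed

lemma omega1_least:
  "\<exists>\<alpha>\<^sub>0\<in>Field omega1. (\<forall>\<alpha>\<in>Field omega1. \<alpha> \<noteq> \<alpha>\<^sub>0 \<longrightarrow> (\<alpha>\<^sub>0, \<alpha>) \<in> omega1 - Id) \<and>
     (\<forall>\<beta>. (\<beta>, \<alpha>\<^sub>0) \<notin> omega1 - Id)"
proof -
  have "Field omega1 \<noteq> {}" using uncountable_omega1 by force
  then obtain \<alpha>\<^sub>0 where a: "\<alpha>\<^sub>0 \<in> Field omega1" "\<And>\<beta>. (\<beta>, \<alpha>\<^sub>0) \<in> omega1 - Id \<Longrightarrow> \<beta> \<notin> Field omega1"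
    using omega1_minimal[of "\<lambda>\<alpha>. \<alpha> \<in> Field omega1"] by blast
  have "(\<beta>, \<alpha>\<^sub>0) \<notin> omega1 - Id" for \<beta> using a(2)[of \<beta>] by (auto simp: Field_def)
  moreover from this have "(\<alpha>\<^sub>0, \<alpha>) \<in> omega1 - Id" if "\<alpha> \<in> Field omega1" "\<alpha> \<noteq> \<alpha>\<^sub>0" for \<alpha>
    using omega1_strict_total[OF a(1) that(1)] that(2) by blast
  ultimately show ?thesis using a(1) by blast
qed

text \<open>\<open>long_ray\<close> has a subspace topology, which for a subset of an ordered space
  can be strictly finer than the order topology of the subset. Here both agree: only the least point
  is removed, and its rays meet the rest in nothing or in everything.\<close>

lemma homeomorphic_long_rayI:
  fixes S :: "'a set"
  assumes "order_iso_on {x \<in> long_ray_points. \<exists>a \<in> long_ray_points. (a, x) \<in> long_ray_less} long_ray_less S r F"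
  shows "order_topology S r homeomorphic_space long_ray"
proof -
  let ?C = long_ray_points and ?q = long_ray_less
  define L where "L = {x \<in> ?C. \<exists>a \<in> ?C. (a, x) \<in> ?q}"
  have tot: "x = y \<or> (x, y) \<in> ?q \<or> (y, x) \<in> ?q" if "x \<in> ?C" "y \<in> ?C" for x y
    using that omega1_strict_total[of "fst x" "fst y"]
    unfolding long_ray_less_def long_ray_points_def by (cases x, cases y) (auto simp del: Diff_iff)
  have top: "topspace (subtopology closed_long_ray L) = L"
    unfolding closed_long_ray_def by (auto simp: L_def)
  have "continuous_map (order_topology L ?q) closed_long_ray (\<lambda>x. x)"
    unfolding closed_long_ray_def
  proof (rule continuous_map_order_topology)
    show "(\<lambda>x. x) \<in> topspace (order_topology L ?q) \<rightarrow> ?C" by (auto simp: L_def)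
    fix a assume a: "a \<in> ?C"
    show "openin (order_topology L ?q) {x \<in> topspace (order_topology L ?q). (x, a) \<in> ?q}"
    proof (cases "a \<in> L")
      case True
      then show ?thesis using openin_below[of a L ?q] by simp
    next
      case False
      then have "{x \<in> topspace (order_topology L ?q). (x, a) \<in> ?q} = {}" using a by (auto simp: L_def)
      then show ?thesis by (simp only: openin_empty)
    qed
    show "openin (order_topology L ?q) {x \<in> topspace (order_topology L ?q). (a, x) \<in> ?q}"
    proof (cases "a \<in> L")
      case True
      then show ?thesis using openin_above[of a L ?q] by simp
    next
      case False
      then have "\<And>x. x \<in> L \<Longrightarrow> (a, x) \<in> ?q" using a tot unfolding L_def by blast
      then have "{x \<in> topspace (order_topology L ?q). (a, x) \<in> ?q} = topspace (order_topology L ?q)" by auto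
      then show ?thesis by (simp only: openin_topspace)
    qed
  qed
  then have 1: "continuous_map (order_topology L ?q) (subtopology closed_long_ray L) (\<lambda>x. x)"
    by (simp add: continuous_map_in_subtopology)
  have 2: "continuous_map (subtopology closed_long_ray L) (order_topology L ?q) (\<lambda>x. x)"
  proof (rule continuous_map_order_topology)
    fix a assume a: "a \<in> L"
    then have aC: "a \<in> ?C" by (simp add: L_def)
    have LC: "L \<subseteq> ?C" by (auto simp: L_def)
    have "{x \<in> topspace (subtopology closed_long_ray L). (x, a) \<in> ?q} = {x \<in> ?C. (x, a) \<in> ?q} \<inter> L"
      "{x \<in> topspace (subtopology closed_long_ray L). (a, x) \<in> ?q} = {x \<in> ?C. (a, x) \<in> ?q} \<inter> L"
      unfolding top using LC by auto
    then show "openin (subtopology closed_long_ray L) {x \<in> topspace (subtopology closed_long_ray L). (x, a) \<in> ?q}"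
      "openin (subtopology closed_long_ray L) {x \<in> topspace (subtopology closed_long_ray L). (a, x) \<in> ?q}"
      using openin_below[OF aC] openin_above[OF aC]
      unfolding closed_long_ray_def by (simp_all only: openin_subtopology_Int)
  qed (simp add: top)
  have "order_topology L ?q homeomorphic_space subtopology closed_long_ray L"
    unfolding homeomorphic_space_def homeomorphic_maps_def using 1 2
    by (intro exI[of _ "\<lambda>x. x"] conjI) simp_all
  moreover have "order_topology L ?q homeomorphic_space order_topology S r"
    using order_iso_on_homeomorphic_space assms unfolding L_def by blast
  ultimately show ?thesis
    unfolding long_ray_def L_def[symmetric]
    using homeomorphic_space_sym homeomorphic_space_trans by blast
qed

section \<open>Tiling a long end along the ordinals\<close>

context ordered_curve
begin

text \<open>A transfinite sequence that takes suprema at limits, with \<open>s\<close> as its successor step.\<close>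

lemma ex_transfinite_sequence:
  assumes nc: "\<not> countable_cofinal" and a: "a \<in> topspace X"
    and s: "\<And>x. x \<in> topspace X \<Longrightarrow> x \<sqsubset> s x"
  obtains g where "\<And>\<alpha>. \<alpha> \<in> Field omega1 \<Longrightarrow> g \<alpha> \<in> topspace X"
    "\<And>\<alpha>. \<alpha> \<in> Field omega1 \<Longrightarrow> a \<sqsubseteq> g \<alpha>"
    "\<And>\<alpha> \<beta>. (\<beta>, \<alpha>) \<in> omega1 - Id \<Longrightarrow> s (g \<beta>) \<sqsubseteq> g \<alpha>"
    "\<And>\<alpha> u. \<alpha> \<in> Field omega1 \<Longrightarrow> u \<in> topspace X \<Longrightarrow> a \<sqsubseteq> u \<Longrightarrow>
       (\<And>\<beta>. (\<beta>, \<alpha>) \<in> omega1 - Id \<Longrightarrow> s (g \<beta>) \<sqsubseteq> u) \<Longrightarrow> g \<alpha> \<sqsubseteq> u"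
proof -
  define is_lub where "is_lub = (\<lambda>A l. l \<in> topspace X \<and> (\<forall>x\<in>A. x \<sqsubseteq> l) \<and>
      (\<forall>u\<in>topspace X. (\<forall>x\<in>A. x \<sqsubseteq> u) \<longrightarrow> l \<sqsubseteq> u))"
  define lub where "lub = (\<lambda>A. SOME l. is_lub A l)"
  \<comment> \<open>Including \<open>a\<close> in the set gives the value at the least index and
    keeps all later values from falling below \<open>a\<close>.\<close>
  define g where "g = wfrec (omega1 - Id)
      (\<lambda>f \<alpha>. lub (insert a ((\<lambda>\<beta>. s (f \<beta>)) ` {\<beta>. (\<beta>, \<alpha>) \<in> omega1 - Id})))"
  have g: "g \<alpha> = lub (insert a ((\<lambda>\<beta>. s (g \<beta>)) ` {\<beta>. (\<beta>, \<alpha>) \<in> omega1 - Id}))" for \<alpha>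
    unfolding g_def
    by (subst wfrec[OF wf_omega1], rule arg_cong[where f = lub], rule arg_cong[where f = "insert a"],
        rule image_cong[OF refl], simp only: cut_apply mem_Collect_eq)
  \<comment> \<open>\<open>lub\<close> picks a supremum if there is one. Existence goes by
    induction: the earlier values lie in the space, there are countably many of them, and a
    countable set is bounded since none is cofinal.\<close>
  have lub: "is_lub (insert a ((\<lambda>\<beta>. s (g \<beta>)) ` {\<beta>. (\<beta>, \<alpha>) \<in> omega1 - Id})) (g \<alpha>)"
    if "\<alpha> \<in> Field omega1" for \<alpha>
    using that
  proof (induction \<alpha> rule: wf_induct_rule[OF wf_omega1])
    case (1 \<alpha>)
    let ?A = "insert a ((\<lambda>\<beta>. s (g \<beta>)) ` {\<beta>. (\<beta>, \<alpha>) \<in> omega1 - Id})"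
    have A: "?A \<subseteq> topspace X"
    proof -
      have "s (g \<beta>) \<in> topspace X" if \<beta>: "(\<beta>, \<alpha>) \<in> omega1 - Id" for \<beta>
      proof -
        have "\<beta> \<in> Field omega1" using \<beta> by (auto simp: Field_def)
        then have "g \<beta> \<in> topspace X" using 1(1)[OF \<beta>] unfolding is_lub_def by blast
        then show ?thesis using s in_space by blast
      qed
      then show ?thesis using a by blast
    qed
    have "countable ?A" using countable_omega1_below[OF 1(2)] by blast
    then obtain y where y: "y \<in> topspace X" "\<And>x. x \<in> ?A \<Longrightarrow> x \<sqsubset> y"
      using countable_bounded[OF nc _ A] by blast
    have "\<exists>l. is_lub ?A l"
      unfolding is_lub_def using ex_lub[OF A insertI1 y(1)] y(2) by blast
    then have "is_lub ?A (lub ?A)" unfolding lub_def by (rule someI_ex)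
    then show ?case by (subst (2) g)
  qed
  have 1: "g \<alpha> \<in> topspace X" "a \<sqsubseteq> g \<alpha>" if "\<alpha> \<in> Field omega1" for \<alpha>
    using lub[OF that] unfolding is_lub_def by blast+
  have 2: "s (g \<beta>) \<sqsubseteq> g \<alpha>" if "(\<beta>, \<alpha>) \<in> omega1 - Id" for \<alpha> \<beta>
  proof -
    have "\<alpha> \<in> Field omega1" using that by (auto simp: Field_def)
    then show ?thesis using lub[of \<alpha>] that unfolding is_lub_def by blast
  qed
  have 3: "g \<alpha> \<sqsubseteq> u" if "\<alpha> \<in> Field omega1" "u \<in> topspace X" "a \<sqsubseteq> u"
    "\<And>\<beta>. (\<beta>, \<alpha>) \<in> omega1 - Id \<Longrightarrow> s (g \<beta>) \<sqsubseteq> u" for \<alpha> u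
    using lub[OF that(1)] that(2-4) unfolding is_lub_def by blast
  show ?thesis by (rule that[OF 1 2 3])
qed

text \<open>A bounded sequence would embed \<open>omega1\<close> into a line and yield uncountably many rationals.\<close>

lemma transfinite_sequence_unbounded:
  assumes g: "\<And>\<alpha>. \<alpha> \<in> Field omega1 \<Longrightarrow> g \<alpha> \<in> topspace X" "\<And>\<alpha>. \<alpha> \<in> Field omega1 \<Longrightarrow> a \<sqsubseteq> g \<alpha>"
    "\<And>\<alpha> \<beta>. (\<beta>, \<alpha>) \<in> omega1 - Id \<Longrightarrow> g \<beta> \<sqsubset> g \<alpha>"
    and a: "a \<in> topspace X" and y: "y \<in> topspace X"
  shows "\<exists>\<alpha>\<in>Field omega1. y \<sqsubset> g \<alpha>"
proof (rule ccontr)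
  assume *: "\<not> (\<exists>\<alpha>\<in>Field omega1. y \<sqsubset> g \<alpha>)"
  obtain h p q where h: "increasing_line X r h" "a = h p" "y = h q"
    using increasing_line_through[OF a y] .
  \<comment> \<open>Every term lies between \<open>a\<close> and \<open>y\<close>, hence on the line
    \<open>h\<close> through them.\<close>
  have "\<exists>t. g \<alpha> = h t" if \<alpha>: "\<alpha> \<in> Field omega1" for \<alpha>
  proof -
    have "g \<alpha> \<sqsubseteq> y" using * \<alpha> not_lt[OF y g(1)[OF \<alpha>]] by blast
    then show ?thesis using increasing_line_convex[OF h(1), of p "g \<alpha>" q] g(2)[OF \<alpha>] h(2,3) by metis
  qed
  then obtain \<tau> where \<tau>: "\<And>\<alpha>. \<alpha> \<in> Field omega1 \<Longrightarrow> g \<alpha> = h (\<tau> \<alpha>)" by metis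
  have \<tau>_less: "\<tau> \<beta> < \<tau> \<alpha>" if "(\<beta>, \<alpha>) \<in> omega1 - Id" for \<alpha> \<beta>
  proof -
    have "\<alpha> \<in> Field omega1" "\<beta> \<in> Field omega1" using that by (auto simp: Field_def)
    then show ?thesis using g(3)[OF that] \<tau> increasing_line_less[OF h(1)] by metis
  qed
  have "\<exists>z. z \<in> \<rat> \<and> \<tau> \<alpha> < z \<and> (\<forall>\<beta>. (\<alpha>, \<beta>) \<in> omega1 - Id \<longrightarrow> z < \<tau> \<beta>)" if \<alpha>: "\<alpha> \<in> Field omega1" for \<alpha>
  proof -
    \<comment> \<open>\<open>\<gamma>\<close> is the successor of \<open>\<alpha>\<close>.\<close>
    obtain \<beta> where \<beta>: "(\<alpha>, \<beta>) \<in> omega1 - Id" using omega1_no_greatest[OF \<alpha>] by blast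
    from omega1_minimal[of "\<lambda>\<beta>. (\<alpha>, \<beta>) \<in> omega1 - Id", OF this]
    obtain \<gamma> where \<gamma>: "(\<alpha>, \<gamma>) \<in> omega1 - Id"
        "\<forall>\<delta>. (\<delta>, \<gamma>) \<in> omega1 - Id \<longrightarrow> (\<alpha>, \<delta>) \<notin> omega1 - Id"
      by (elim exE conjE)
    obtain z where z: "z \<in> \<rat>" "\<tau> \<alpha> < z" "z < \<tau> \<gamma>"
      using Rats_dense_in_real[OF \<tau>_less[OF \<gamma>(1)]] by blast
    have "z < \<tau> \<delta>" if \<delta>: "(\<alpha>, \<delta>) \<in> omega1 - Id" for \<delta>
    proof -
      have "\<gamma> \<in> Field omega1" "\<delta> \<in> Field omega1" using \<gamma>(1) \<delta> by (auto simp: Field_def)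
      then have "\<gamma> = \<delta> \<or> (\<gamma>, \<delta>) \<in> omega1 - Id" using omega1_strict_total \<gamma>(2) \<delta> by blast
      then show ?thesis using z(3) \<tau>_less[of \<gamma> \<delta>] by (metis order_less_trans)
    qed
    then show ?thesis using z by blast
  qed
  then obtain \<zeta> where \<zeta>: "\<And>\<alpha>. \<alpha> \<in> Field omega1 \<Longrightarrow> \<zeta> \<alpha> \<in> \<rat> \<and> \<tau> \<alpha> < \<zeta> \<alpha>"
      "\<And>\<alpha> \<beta>. \<alpha> \<in> Field omega1 \<Longrightarrow> (\<alpha>, \<beta>) \<in> omega1 - Id \<Longrightarrow> \<zeta> \<alpha> < \<tau> \<beta>"
    by metis
  have less: "\<zeta> \<alpha> < \<zeta> \<beta>" if "(\<alpha>, \<beta>) \<in> omega1 - Id" for \<alpha> \<beta>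
  proof -
    have "\<alpha> \<in> Field omega1" "\<beta> \<in> Field omega1" using that by (auto simp: Field_def)
    then show ?thesis using \<zeta>(1)[of \<beta>] \<zeta>(2)[OF _ that] by auto
  qed
  have "inj_on \<zeta> (Field omega1)"
  proof (rule inj_onI)
    fix \<alpha> \<beta> assume "\<alpha> \<in> Field omega1" "\<beta> \<in> Field omega1" "\<zeta> \<alpha> = \<zeta> \<beta>"
    then show "\<alpha> = \<beta>" using omega1_strict_total[of \<alpha> \<beta>] less[of \<alpha> \<beta>] less[of \<beta> \<alpha>] by auto
  qed
  moreover have "countable (\<zeta> ` Field omega1)"
    by (rule countable_subset[OF _ countable_rat]) (use \<zeta>(1) in blast)
  ultimately have "countable (Field omega1)" using countable_image_inj_on by blast
  with uncountable_omega1 show False by blast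
qed

text \<open>The half-open pieces from \<open>g \<alpha>\<close> to \<open>s (g \<alpha>)\<close>
  tile everything from \<open>a\<close> on, as \<open>g\<close> takes suprema and is unbounded. Each
  piece is a copy of \<open>{0..<1}\<close>, so the order becomes the lexicographic order of index
  and position. The countable end below \<open>a\<close> is absorbed into the least piece.\<close>

lemma homeomorphic_long_ray:
  assumes ne: "topspace X \<noteq> {}" and ci: countable_coinitial and nc: "\<not> countable_cofinal"
  shows "X homeomorphic_space long_ray"
proof -
  obtain a where a: "a \<in> topspace X" using ne by blast
  have "\<forall>x\<in>topspace X. \<exists>y. x \<sqsubset> y" using no_greatest by blast
  then obtain s where s: "\<And>x. x \<in> topspace X \<Longrightarrow> x \<sqsubset> s x" by metis
  obtain g where g: "\<And>\<alpha>. \<alpha> \<in> Field omega1 \<Longrightarrow> g \<alpha> \<in> topspace X"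
    "\<And>\<alpha>. \<alpha> \<in> Field omega1 \<Longrightarrow> a \<sqsubseteq> g \<alpha>"
    "\<And>\<alpha> \<beta>. (\<beta>, \<alpha>) \<in> omega1 - Id \<Longrightarrow> s (g \<beta>) \<sqsubseteq> g \<alpha>"
    "\<And>\<alpha> u. \<alpha> \<in> Field omega1 \<Longrightarrow> u \<in> topspace X \<Longrightarrow> a \<sqsubseteq> u \<Longrightarrow>
       (\<And>\<beta>. (\<beta>, \<alpha>) \<in> omega1 - Id \<Longrightarrow> s (g \<beta>) \<sqsubseteq> u) \<Longrightarrow> g \<alpha> \<sqsubseteq> u"
    using ex_transfinite_sequence[OF nc a s] by blast
  have sg: "g \<alpha> \<sqsubset> s (g \<alpha>)" if "\<alpha> \<in> Field omega1" for \<alpha> using s[OF g(1)[OF that]] .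
  have g_less: "g \<beta> \<sqsubset> g \<alpha>" if "(\<beta>, \<alpha>) \<in> omega1 - Id" for \<alpha> \<beta>
  proof -
    have "\<beta> \<in> Field omega1" using that by (auto simp: Field_def)
    from lt_le_trans[OF sg[OF this] g(3)[OF that]] show ?thesis .
  qed
  have cover: "\<exists>\<alpha>\<in>Field omega1. g \<alpha> \<sqsubseteq> x \<and> x \<sqsubset> s (g \<alpha>)" if x: "x \<in> topspace X" "a \<sqsubseteq> x" for x
  proof -
    have "\<exists>\<alpha>\<in>Field omega1. x \<sqsubset> g \<alpha>"
      by (rule transfinite_sequence_unbounded[of g, OF g(1,2) g_less a x(1)])
    then obtain \<alpha> where "\<alpha> \<in> Field omega1" "x \<sqsubset> g \<alpha>" by (elim bexE)
    then have "\<alpha> \<in> Field omega1 \<and> x \<sqsubset> s (g \<alpha>)" using sg[of \<alpha>] trans[of x "g \<alpha>"] by simp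
    \<comment> \<open>At the least index whose piece ends beyond \<open>x\<close>, all earlier
      pieces end at or before \<open>x\<close>, and \<open>g\<close> at this index is the supremum
      of \<open>a\<close> and these ends.\<close>
    from omega1_minimal[of "\<lambda>\<alpha>. \<alpha> \<in> Field omega1 \<and> x \<sqsubset> s (g \<alpha>)", OF this]
    obtain \<gamma> where \<gamma>: "\<gamma> \<in> Field omega1" "x \<sqsubset> s (g \<gamma>)" and
        \<gamma>3: "\<forall>\<beta>. (\<beta>, \<gamma>) \<in> omega1 - Id \<longrightarrow> \<not> (\<beta> \<in> Field omega1 \<and> x \<sqsubset> s (g \<beta>))"
      by (elim exE conjE)
    have "g \<gamma> \<sqsubseteq> x"
    proof (rule g(4)[OF \<gamma>(1) x])
      fix \<beta> assume \<beta>: "(\<beta>, \<gamma>) \<in> omega1 - Id"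
      then have \<beta>F: "\<beta> \<in> Field omega1" by (auto simp: Field_def)
      then have "\<not> x \<sqsubset> s (g \<beta>)" using \<gamma>3 \<beta> by (metis (no_types))
      then show "s (g \<beta>) \<sqsubseteq> x" using not_lt[OF x(1)] in_space[OF sg[OF \<beta>F]] by blast
    qed
    with \<gamma> show ?thesis by blast
  qed
  obtain \<alpha>\<^sub>0 where z: "\<alpha>\<^sub>0 \<in> Field omega1" "\<And>\<alpha>. \<alpha> \<in> Field omega1 \<Longrightarrow> \<alpha> \<noteq> \<alpha>\<^sub>0 \<Longrightarrow> (\<alpha>\<^sub>0, \<alpha>) \<in> omega1 - Id"
    "\<And>\<beta>. (\<beta>, \<alpha>\<^sub>0) \<notin> omega1 - Id"
    using omega1_least by metis
  define b where "b = s (g \<alpha>\<^sub>0)"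
  have b: "b \<in> topspace X" "a \<sqsubset> b"
    using in_space[OF sg[OF z(1)]] le_lt_trans[OF g(2)[OF z(1)] sg[OF z(1)]] unfolding b_def by auto
  obtain G where G: "order_iso_on UNIV {(s::real, t). s < t} {x \<in> topspace X. x \<sqsubset> b} r G"
    using below_order_iso[OF b(1) ci] by blast
  have G_less: "G s \<sqsubset> G t" if "s < t" for s t using G that by (simp add: order_iso_on_def)
  have G_range: "range G = {x \<in> topspace X. x \<sqsubset> b}" using G by (simp add: order_iso_on_def bij_betw_def)
  define Q where "Q = (\<lambda>\<alpha> e. (\<forall>t u. e t \<sqsubset> e u \<longleftrightarrow> t < u) \<and> e (0::real) = g \<alpha> \<and> e 1 = s (g \<alpha>) \<and>
      (\<forall>z. g \<alpha> \<sqsubseteq> z \<longrightarrow> z \<sqsubset> s (g \<alpha>) \<longrightarrow> (\<exists>t. 0 \<le> t \<and> t < 1 \<and> z = e t)))"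
  have "\<exists>e. Q \<alpha> e" if \<alpha>: "\<alpha> \<in> Field omega1" for \<alpha>
  proof (rule ex_unit_parametrization[OF sg[OF \<alpha>]])
    fix f :: "real \<Rightarrow> 'a"
    assume "\<And>t u. f t \<sqsubset> f u \<longleftrightarrow> t < u" "f 0 = g \<alpha>" "f 1 = s (g \<alpha>)"
      "\<And>z. g \<alpha> \<sqsubseteq> z \<Longrightarrow> z \<sqsubset> s (g \<alpha>) \<Longrightarrow> \<exists>t. 0 \<le> t \<and> t < 1 \<and> z = f t"
    then have "Q \<alpha> f" unfolding Q_def by (intro conjI allI impI)
    then show ?thesis by blast
  qed
  then have "\<exists>e. \<forall>\<alpha>\<in>Field omega1. Q \<alpha> (e \<alpha>)" by (intro bchoice ballI)
  then obtain e where Q: "\<And>\<alpha>. \<alpha> \<in> Field omega1 \<Longrightarrow> Q \<alpha> (e \<alpha>)" by (elim exE) blast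
  have e: "e \<alpha> t \<sqsubset> e \<alpha> u \<longleftrightarrow> t < u" "e \<alpha> (0::real) = g \<alpha>" "e \<alpha> 1 = s (g \<alpha>)"
      "g \<alpha> \<sqsubseteq> z \<Longrightarrow> z \<sqsubset> s (g \<alpha>) \<Longrightarrow> \<exists>t. 0 \<le> t \<and> t < 1 \<and> z = e \<alpha> t"
    if "\<alpha> \<in> Field omega1" for \<alpha> t u z
    using Q[OF that] unfolding Q_def by (simp_all only:)
  have e_ge: "g \<alpha> \<sqsubseteq> e \<alpha> t" if "\<alpha> \<in> Field omega1" "0 \<le> t" for \<alpha> t
    using that e(1)[of \<alpha> 0 t] e(2)[of \<alpha>] by (cases "t = 0") simp_all
  have e_lt: "e \<alpha> t \<sqsubset> s (g \<alpha>)" if "\<alpha> \<in> Field omega1" "t < 1" for \<alpha> t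
    using that e(1)[of \<alpha> t 1] e(3)[of \<alpha>] by simp
  \<comment> \<open>The least piece of the long ray lacks its initial point and has to cover everything below \<open>b\<close>.\<close>
  define F where "F = (\<lambda>(\<alpha>, t). if \<alpha> = \<alpha>\<^sub>0 then G (tan (pi * t - pi / 2)) else e \<alpha> t)"
  define L where "L = {x \<in> long_ray_points. \<exists>a \<in> long_ray_points. (a, x) \<in> long_ray_less}"
  \<comment> \<open>The initial point of the closed long ray is
    \<open>(\<alpha>\<^sub>0, 0)\<close>, so the position 0 is missing only at the least
    index.\<close>
  have L: "(\<alpha>, t) \<in> L \<longleftrightarrow> \<alpha> \<in> Field omega1 \<and> 0 \<le> t \<and> t < 1 \<and> (\<alpha> = \<alpha>\<^sub>0 \<longrightarrow> 0 < t)" for \<alpha> t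
  proof
    assume "(\<alpha>, t) \<in> L"
    then obtain \<beta> u where p: "(\<alpha>, t) \<in> long_ray_points" "(\<beta>, u) \<in> long_ray_points"
        "((\<beta>, u), (\<alpha>, t)) \<in> long_ray_less"
      unfolding L_def by auto
    have "\<alpha> \<in> Field omega1" "0 \<le> t" "t < 1" "0 \<le> u"
      using p(1,2) by (simp_all add: long_ray_points_def)
    moreover have "(\<beta>, \<alpha>) \<in> omega1 - Id \<or> \<beta> = \<alpha> \<and> u < t"
      using p(3) by (simp add: long_ray_less_def)
    ultimately show "\<alpha> \<in> Field omega1 \<and> 0 \<le> t \<and> t < 1 \<and> (\<alpha> = \<alpha>\<^sub>0 \<longrightarrow> 0 < t)" using z(3)[of \<beta>] by auto
  next
    assume *: "\<alpha> \<in> Field omega1 \<and> 0 \<le> t \<and> t < 1 \<and> (\<alpha> = \<alpha>\<^sub>0 \<longrightarrow> 0 < t)"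
    then have "((\<alpha>\<^sub>0, 0), (\<alpha>, t)) \<in> long_ray_less" using z(2)[of \<alpha>]
      unfolding long_ray_less_def by auto
    moreover have "(\<alpha>\<^sub>0, 0) \<in> long_ray_points" "(\<alpha>, t) \<in> long_ray_points"
      using * z(1) by (auto simp: long_ray_points_def)
    ultimately show "(\<alpha>, t) \<in> L" unfolding L_def by blast
  qed
  \<comment> \<open>Rescaled in this way, \<open>tan\<close> maps the open unit interval
    increasingly onto the reals; the inverse is \<open>arctan y / pi + 1 / 2\<close>.\<close>
  have tan_less: "tan (pi * t - pi / 2) < tan (pi * u - pi / 2)" if "0 < t" "t < u" "u < 1" for t u
    by (rule tan_monotone) (use that pi_gt_zero in \<open>simp_all\<close>)
  have F0: "F (\<alpha>\<^sub>0, t) \<sqsubset> b" for t using G_range unfolding F_def by auto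
  have "order_iso_on L long_ray_less (topspace X) r F"
  proof (rule order_iso_onI)
    show "F ` L = topspace X"
    proof (intro equalityI subsetI)
      fix x assume "x \<in> F ` L"
      then obtain \<alpha> t where "(\<alpha>, t) \<in> L" "x = F (\<alpha>, t)" by auto
      then show "x \<in> topspace X"
        using F0[of t] in_space e_lt[of \<alpha> t] L[of \<alpha> t] unfolding F_def by (auto split: if_splits)
    next
      fix x assume x: "x \<in> topspace X"
      show "x \<in> F ` L"
      proof (cases "x \<sqsubset> b")
        case True
        then obtain y where y: "x = G y" using G_range x by blast
        define t where "t = arctan y / pi + 1 / 2"
        have "arctan y / pi > - (1/2)" "arctan y / pi < 1/2"
          using arctan_lbound[of y] arctan_ubound[of y] pi_gt_zero by (simp_all add: field_simps)
        then have "0 < t" "t < 1" unfolding t_def by linarith+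
        then have "(\<alpha>\<^sub>0, t) \<in> L" unfolding L using z(1) by simp
        moreover have "pi * t - pi / 2 = arctan y" unfolding t_def by (simp add: field_simps)
        then have "F (\<alpha>\<^sub>0, t) = x" unfolding F_def y by (simp add: tan_arctan)
        ultimately show ?thesis by blast
      next
        case False
        then have bx: "b \<sqsubseteq> x" using not_lt[OF x b(1)] by blast
        then have "a \<sqsubseteq> x" using b(2) trans by blast
        then obtain \<alpha> where \<alpha>: "\<alpha> \<in> Field omega1" "g \<alpha> \<sqsubseteq> x" "x \<sqsubset> s (g \<alpha>)" using cover[OF x] by blast
        then have "\<alpha> \<noteq> \<alpha>\<^sub>0" using False unfolding b_def by blast
        obtain t where "0 \<le> t" "t < 1" "x = e \<alpha> t" using e(4)[OF \<alpha>] by blast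
        then have "(\<alpha>, t) \<in> L" "F (\<alpha>, t) = x" unfolding L F_def using \<open>\<alpha> \<noteq> \<alpha>\<^sub>0\<close> \<alpha>(1) by simp_all
        then show ?thesis by blast
      qed
    qed
    fix x y assume xy: "x \<in> L" "y \<in> L"
    obtain \<alpha> t \<beta> u where eq: "x = (\<alpha>, t)" "y = (\<beta>, u)" by (cases x, cases y)
    have \<alpha>: "\<alpha> \<in> Field omega1" "0 \<le> t" "t < 1" "\<alpha> = \<alpha>\<^sub>0 \<longrightarrow> 0 < t" using xy(1) L eq by auto
    have \<beta>: "\<beta> \<in> Field omega1" "0 \<le> u" "u < 1" "\<beta> = \<alpha>\<^sub>0 \<longrightarrow> 0 < u" using xy(2) L eq by auto
    show "x = y \<or> (x, y) \<in> long_ray_less \<or> (y, x) \<in> long_ray_less"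
      using omega1_strict_total[OF \<alpha>(1) \<beta>(1)] unfolding eq long_ray_less_def by auto
    assume "(x, y) \<in> long_ray_less"
    then consider "(\<alpha>, \<beta>) \<in> omega1 - Id" | "\<alpha> = \<beta>" "t < u"
      unfolding eq long_ray_less_def by auto
    then show "F x \<sqsubset> F y"
    proof cases
      case 1
      then have "\<beta> \<noteq> \<alpha>\<^sub>0" using z(3) by blast
      \<comment> \<open>Points in different pieces are separated by the end
        \<open>s (g \<alpha>)\<close> of the lower piece.\<close>
      have l: "F x \<sqsubset> s (g \<alpha>)"
        using F0[of t] e_lt[OF \<alpha>(1,3)] unfolding eq b_def by (auto simp: F_def)
      have "s (g \<alpha>) \<sqsubseteq> F y"
        using le_trans[OF g(3)[OF 1] e_ge[OF \<beta>(1,2)]] \<open>\<beta> \<noteq> \<alpha>\<^sub>0\<close> unfolding eq F_def by simp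
      with l show ?thesis by (rule lt_le_trans)
    next
      case 2
      show ?thesis
      proof (cases "\<alpha> = \<alpha>\<^sub>0")
        case True
        then show ?thesis using G_less[OF tan_less[of t u]] 2 \<alpha> \<beta> unfolding eq F_def by simp
      next
        case False
        then show ?thesis using e(1)[OF \<alpha>(1), of t u] 2 unfolding eq F_def by simp
      qed
    qed
  qed simp
  then have "order_topology (topspace X) r homeomorphic_space long_ray"
    unfolding L_def by (rule homeomorphic_long_rayI)
  then show ?thesis unfolding topology_eq[symmetric] .
qed

section \<open>Classification by the two ends\<close>

text \<open>The long ray is not separable. With a view to the ambient manifold the curve is
  therefore split at \<open>a\<close>: rational points are dense below, and the closed half-line
  above is sequentially compact.\<close>

lemma long_end:
  assumes ne: "topspace X \<noteq> {}" and ci: countable_coinitial and nc: "\<not> countable_cofinal"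
  shows "X homeomorphic_space long_ray \<and>
    (\<exists>K D. seq_compactin X K \<and> countable D \<and> D \<subseteq> topspace X \<and> topspace X \<subseteq> X closure_of D \<union> K)"
proof -
  obtain a where a: "a \<in> topspace X" using ne by blast
  obtain D where D: "countable D" "D \<subseteq> topspace X" "{x. x \<sqsubset> a} \<subseteq> X closure_of D"
    using ex_countable_dense_below[OF ci a] .
  have "topspace X \<subseteq> X closure_of D \<union> {x. a \<sqsubseteq> x}"
  proof
    fix x assume "x \<in> topspace X"
    then show "x \<in> X closure_of D \<union> {x. a \<sqsubseteq> x}" using total[OF _ a, of x] D(3) by blast
  qed
  then show ?thesis
    using homeomorphic_long_ray[OF assms] seq_compactin_above[OF nc a] D(1,2) by blast
qed

text \<open>Reversing the order exchanges the ends, so a single long end may be taken to be the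
  upper one.\<close>

theorem classification:
  assumes ne: "topspace X \<noteq> {}" and ns: "\<not> seq_compactin X (topspace X)"
  shows "X homeomorphic_space euclideanreal \<or> X homeomorphic_space long_ray \<and>
    (\<exists>K D. seq_compactin X K \<and> countable D \<and> D \<subseteq> topspace X \<and> topspace X \<subseteq> X closure_of D \<union> K)"
proof -
  interpret conv: ordered_curve X "r\<inverse>" by (rule converse_ordered_curve)
  have 1: "conv.countable_coinitial \<longleftrightarrow> countable_cofinal"
    unfolding conv.countable_coinitial_def countable_cofinal_def by (simp add: eq_commute)
  have 2: "conv.countable_cofinal \<longleftrightarrow> countable_coinitial"
    unfolding conv.countable_cofinal_def countable_coinitial_def by (simp add: eq_commute)
  show ?thesis
  proof (cases "countable_cofinal")
    case True
    then show ?thesis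
      using homeomorphic_real[OF ne _ True] conv.long_end[OF ne] 1 2 by blast
  next
    case False
    then have countable_coinitial using seq_compactin_topspace ns by blast
    then show ?thesis using long_end[OF ne _ False] by blast
  qed
qed

end

section \<open>Leaves\<close>

lemma metrizable_Euclidean_space: "metrizable_space (Euclidean_space n)"
  unfolding Euclidean_space_def
  by (intro metrizable_space_subtopology)
     (simp add: metrizable_space_product_topology metrizable_space_euclidean)

lemma separable_euclideanreal: "separable_space euclideanreal"
  unfolding separable_space_def
  by (intro exI[of _ \<rat>] conjI) (simp_all add: countable_rat Rats_closure_real)

lemma seq_compactin_coarser:
  assumes "seq_compactin T K" "topspace T = topspace M" "\<And>U. openin M U \<Longrightarrow> openin T U"
  shows "seq_compactin M K"
proof -
  have "limitin M f l F" if "limitin T f l F" for f l and F :: "nat filter"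
    using that assms(2,3) unfolding limitin_def by simp
  then show ?thesis using assms(1,2) unfolding seq_compactin_def by metis
qed

lemma seq_compactin_subtopology_imp:
  assumes "seq_compactin (subtopology T S) K"
  shows "seq_compactin T K"
  using assms unfolding seq_compactin_def limitin_subtopology topspace_subtopology by blast

text \<open>In a metrizable neighbourhood a closure point is the limit of a sequence in
  \<open>K\<close>; a subsequence has a limit in \<open>K\<close>, and limits are unique.\<close>

lemma closedin_if_seq_compactin:
  assumes K: "seq_compactin M K" and H: "Hausdorff_space M"
    and met: "\<And>p. p \<in> topspace M \<Longrightarrow> \<exists>U. openin M U \<and> p \<in> U \<and> metrizable_space (subtopology M U)"
  shows "closedin M K"
proof -
  have "p \<in> K" if p: "p \<in> M closure_of K" for p
  proof -
    have "p \<in> topspace M" using p by (simp add: in_closure_of)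
    then obtain U where U: "openin M U" "p \<in> U" "metrizable_space (subtopology M U)" using met by blast
    then obtain A d where A: "Metric_space A d" "subtopology M U = Metric_space.mtopology A d"
      unfolding metrizable_space_def by blast
    have "p \<in> subtopology M U closure_of K"
      using p U(1,2) by (simp add: closure_of_subtopology_open)
    then obtain \<sigma> where \<sigma>: "range \<sigma> \<subseteq> K" "limitin (subtopology M U) \<sigma> p sequentially"
      unfolding A(2) Metric_space.closure_of_sequentially[OF A(1)] by blast
    then have l: "limitin M \<sigma> p sequentially" by (simp add: limitin_subtopology)
    have "\<sigma> i \<in> K" for i using \<sigma>(1) by blast
    then obtain q r where q: "q \<in> K" "strict_mono r" "limitin M (\<sigma> \<circ> r) q sequentially"
      using seq_compactinD[OF K] by metis
    have "p = q"
      by (rule limitin_Hausdorff_unique[OF limitin_subsequence[OF q(2) l] q(3) _ H]) simp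
    then show ?thesis using q(1) by simp
  qed
  moreover have "K \<subseteq> topspace M" using K by (simp add: seq_compactin_def)
  ultimately show ?thesis using closure_of_subset_eq by blast
qed

text \<open>Putting coordinate 0 back inverts the splitting of a point into its coordinate 0 and its
  \<open>transverse\<close> part.\<close>

definition line_over :: "(nat \<Rightarrow> real) \<Rightarrow> real \<Rightarrow> nat \<Rightarrow> real" where
  "line_over y t = case_nat t y"

lemma transverse_line_over [simp]: "transverse (line_over y t) = y"
  by (simp add: transverse_def line_over_def)

lemma line_over_0 [simp]: "line_over y t 0 = t"
  by (simp add: line_over_def)

lemma line_over_transverse: "line_over (transverse x) (x 0) = x"
  by (rule ext) (simp add: transverse_def line_over_def split: nat.split)

text \<open>On the line through a point of the space only coordinate 0 varies, so the coordinates
  from \<open>n\<close> on stay zero.\<close>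

lemma continuous_line_over:
  assumes "x \<in> topspace (Euclidean_space n)" "n \<ge> 1"
  shows "continuous_map euclideanreal (Euclidean_space n) (line_over (transverse x))"
  unfolding Euclidean_space_def continuous_map_in_subtopology
proof
  show "continuous_map euclideanreal (powertop_real UNIV) (line_over (transverse x))"
    unfolding continuous_map_componentwise_UNIV
  proof
    fix k
    show "continuous_map euclideanreal euclideanreal (\<lambda>t. line_over (transverse x) t k)"
      by (cases k) (simp_all add: line_over_def)
  qed
  show "line_over (transverse x) \<in> topspace euclideanreal \<rightarrow> {x. \<forall>i\<ge>n. x i = 0}"
    using assms by (auto simp: topspace_Euclidean_space line_over_def transverse_def split: nat.split)
qed

section \<open>The leaf topology and its plaques\<close>

locale foliated_manifold =
  fixes n :: nat and M :: "'a topology" and \<F> :: "('a set \<times> ('a \<Rightarrow> nat \<Rightarrow> real)) set"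
  assumes dim: "n \<ge> 2" and manifold: "manifold n M" and foliation: "foliation1 n M \<F>"
begin

abbreviation T :: "'a topology" where "T \<equiv> leaf_topology M \<F>"

lemma Hausdorff_M: "Hausdorff_space M"
  using manifold by (simp add: manifold_def)

lemma chart_at:
  assumes "p \<in> topspace M"
  obtains U \<phi> where "(U, \<phi>) \<in> \<F>" "p \<in> U"
proof -
  have "p \<in> (\<Union>(U, \<phi>)\<in>\<F>. U)" using assms foliation by (simp add: foliation1_def)
  then show ?thesis using that by auto
qed

lemma chartD:
  assumes "(U, \<phi>) \<in> \<F>"
  shows "openin M U" "openin (Euclidean_space n) (\<phi> ` U)"
    "homeomorphic_map (subtopology M U) (subtopology (Euclidean_space n) (\<phi> ` U)) \<phi>"
proof -
  have "chart n M U \<phi>" using assms foliation by (auto simp: foliation1_def)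
  then show "openin M U" "openin (Euclidean_space n) (\<phi> ` U)"
    "homeomorphic_map (subtopology M U) (subtopology (Euclidean_space n) (\<phi> ` U)) \<phi>"
    by (simp_all add: chart_def)
qed

lemma chart_transition:
  assumes "(U, \<phi>) \<in> \<F>" "(V, \<psi>) \<in> \<F>" "p \<in> U" "p \<in> V"
  obtains W g where "openin M W" "p \<in> W" "W \<subseteq> U \<inter> V"
    "\<forall>q\<in>W. transverse (\<psi> q) = g (transverse (\<phi> q))"
proof -
  have "\<forall>(U, \<phi>) \<in> \<F>. \<forall>(V, \<psi>) \<in> \<F>. \<forall>p \<in> U \<inter> V.
        \<exists>W g. openin M W \<and> p \<in> W \<and> W \<subseteq> U \<inter> V \<and> (\<forall>q \<in> W. transverse (\<psi> q) = g (transverse (\<phi> q)))"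
    using foliation by (simp add: foliation1_def)
  from bspec[OF this assms(1)]
  have "\<forall>(V, \<psi>) \<in> \<F>. \<forall>p \<in> U \<inter> V.
        \<exists>W g. openin M W \<and> p \<in> W \<and> W \<subseteq> U \<inter> V \<and> (\<forall>q \<in> W. transverse (\<psi> q) = g (transverse (\<phi> q)))"
    by (simp only: prod.case)
  from bspec[OF this assms(2)]
  have "\<forall>p \<in> U \<inter> V.
        \<exists>W g. openin M W \<and> p \<in> W \<and> W \<subseteq> U \<inter> V \<and> (\<forall>q \<in> W. transverse (\<psi> q) = g (transverse (\<phi> q)))"
    by (simp only: prod.case)
  then show ?thesis using assms(3,4) that by (meson IntI)
qed

lemma chart_inverse:
  assumes "(U, \<phi>) \<in> \<F>"
  obtains \<psi> where "continuous_map (subtopology (Euclidean_space n) (\<phi> ` U)) (subtopology M U) \<psi>"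
    "\<And>q. q \<in> U \<Longrightarrow> \<psi> (\<phi> q) = q" "\<And>x. x \<in> \<phi> ` U \<Longrightarrow> \<psi> x \<in> U \<and> \<phi> (\<psi> x) = x"
proof -
  note c = chartD[OF assms]
  obtain \<psi> where \<psi>: "homeomorphic_maps (subtopology M U) (subtopology (Euclidean_space n) (\<phi> ` U)) \<phi> \<psi>"
    using c(3) homeomorphic_map_maps by blast
  have top: "topspace (subtopology M U) = U" using openin_subset[OF c(1)] by auto
  have 1: "continuous_map (subtopology (Euclidean_space n) (\<phi> ` U)) (subtopology M U) \<psi>"
    using \<psi> by (simp add: homeomorphic_maps_def)
  have 2: "\<psi> (\<phi> q) = q" if "q \<in> U" for q
    using \<psi> that unfolding homeomorphic_maps_def top by blast
  have 3: "\<psi> x \<in> U \<and> \<phi> (\<psi> x) = x" if x: "x \<in> \<phi> ` U" for x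
  proof -
    obtain q where "q \<in> U" "x = \<phi> q" using x by blast
    then show ?thesis using 2 by simp
  qed
  show ?thesis by (rule that[OF 1 2 3])
qed

lemma openin_plaque:
  assumes "(U, \<phi>) \<in> \<F>" "openin M W" "W \<subseteq> U"
  shows "openin T {p \<in> W. transverse (\<phi> p) = y}"
  unfolding leaf_topology_def by (rule topology_generated_by_Basis) (use assms in blast)

text \<open>Each point of \<open>W\<close> has a piece of plaque inside \<open>W\<close>, so the
  leaf topology is finer than that of \<open>M\<close>.\<close>

lemma openin_leaf_topology:
  assumes "openin M W"
  shows "openin T W"
proof (subst openin_subopen, intro ballI)
  fix p assume p: "p \<in> W"
  then obtain U \<phi> where U: "(U, \<phi>) \<in> \<F>" "p \<in> U" using chart_at openin_subset[OF assms] by blast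
  have "openin T {q \<in> W \<inter> U. transverse (\<phi> q) = transverse (\<phi> p)}"
    using openin_plaque[OF U(1)] assms chartD(1)[OF U(1)] by blast
  then show "\<exists>V. openin T V \<and> p \<in> V \<and> V \<subseteq> W" using p U(2) by blast
qed

lemma topspace_T: "topspace T = topspace M"
proof
  show "topspace T \<subseteq> topspace M"
    unfolding leaf_topology_def topology_generated_by_topspace using openin_subset by blast
  show "topspace M \<subseteq> topspace T" by (rule openin_subset[OF openin_leaf_topology]) simp
qed

lemma Hausdorff_T: "Hausdorff_space T"
  by (rule Hausdorff_space_expansive[OF Hausdorff_M topspace_T[symmetric] openin_leaf_topology])

lemma locally_metrizable:
  assumes "p \<in> topspace M"
  shows "\<exists>U. openin M U \<and> p \<in> U \<and> metrizable_space (subtopology M U)"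
proof -
  obtain U \<phi> where U: "(U, \<phi>) \<in> \<F>" "p \<in> U" using chart_at[OF assms] .
  have "subtopology M U homeomorphic_space subtopology (Euclidean_space n) (\<phi> ` U)"
    using chartD(3)[OF U(1)] by (rule homeomorphic_map_imp_homeomorphic_space)
  then have "metrizable_space (subtopology M U)"
    using homeomorphic_metrizable_space metrizable_space_subtopology[OF metrizable_Euclidean_space] by blast
  then show ?thesis using U chartD(1) by blast
qed

lemma seq_compactin_M: "seq_compactin T K \<Longrightarrow> seq_compactin M K"
  by (rule seq_compactin_coarser[OF _ topspace_T openin_leaf_topology])

lemma closedin_M: "seq_compactin T K \<Longrightarrow> closedin M K"
  by (rule closedin_if_seq_compactin[OF seq_compactin_M Hausdorff_M locally_metrizable])

text \<open>A sequence in a transversal that converges in \<open>M\<close> meets each plaque only finitely often, so it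
  has no subsequence that converges in the leaf topology.\<close>

lemma seq_compactin_empty_interior:
  assumes K: "seq_compactin T K" and W: "openin M W" "W \<subseteq> K"
  shows "W = {}"
proof (rule ccontr)
  assume "W \<noteq> {}"
  then obtain p where p: "p \<in> W" by blast
  then obtain U \<phi> where U: "(U, \<phi>) \<in> \<F>" "p \<in> U" using chart_at openin_subset[OF W(1)] by blast
  note c = chartD[OF U(1)]
  obtain \<psi> where \<psi>: "continuous_map (subtopology (Euclidean_space n) (\<phi> ` U)) (subtopology M U) \<psi>"
    "\<And>q. q \<in> U \<Longrightarrow> \<psi> (\<phi> q) = q" "\<And>x. x \<in> \<phi> ` U \<Longrightarrow> \<psi> x \<in> U \<and> \<phi> (\<psi> x) = x"
    using chart_inverse[OF U(1)] by metis
  \<comment> \<open>Coordinate 1 is transverse to the leaves and is available because the dimension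
    is at least 2; moving along it changes the plaque.\<close>
  define \<xi> where "\<xi> = (\<lambda>t. (\<phi> p)(1 := \<phi> p 1 + t))"
  have \<phi>p: "\<phi> p \<in> topspace (Euclidean_space n)" using openin_subset[OF c(2)] U(2) by blast
  have c\<xi>: "continuous_map euclideanreal (Euclidean_space n) \<xi>"
    unfolding Euclidean_space_def continuous_map_in_subtopology
  proof
    show "continuous_map euclideanreal (powertop_real UNIV) \<xi>"
      unfolding continuous_map_componentwise_UNIV
    proof
      fix k
      have "continuous_on UNIV (\<lambda>t. \<phi> p 1 + t)" by (intro continuous_intros)
      then show "continuous_map euclideanreal euclideanreal (\<lambda>t. \<xi> t k)"
        by (cases "k = 1") (simp_all add: \<xi>_def)
    qed
    show "\<xi> \<in> topspace euclideanreal \<rightarrow> {x. \<forall>i\<ge>n. x i = 0}"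
      using \<phi>p dim by (auto simp: topspace_Euclidean_space \<xi>_def)
  qed
  have "openin (subtopology M U) (U \<inter> W)" using W(1) by (simp add: openin_subtopology_Int2)
  then have "openin (subtopology (Euclidean_space n) (\<phi> ` U)) (\<phi> ` (U \<inter> W))"
    using homeomorphic_imp_open_map[OF c(3)] unfolding open_map_def by blast
  then have "openin (Euclidean_space n) (\<phi> ` (U \<inter> W))" using c(2) openin_trans_full by blast
  from openin_continuous_map_preimage[OF c\<xi> this]
  have "open {t. \<xi> t \<in> \<phi> ` (U \<inter> W)}" by simp
  moreover have "\<xi> 0 = \<phi> p" by (simp add: \<xi>_def)
  then have "0 \<in> {t. \<xi> t \<in> \<phi> ` (U \<inter> W)}" using p U(2) by simp
  ultimately obtain e where e: "e > 0" "ball 0 e \<subseteq> {t. \<xi> t \<in> \<phi> ` (U \<inter> W)}"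
    using open_contains_ball by blast
  \<comment> \<open>The denominators start at 2, so that already the first term is strictly below
    the radius \<open>e\<close>.\<close>
  define \<theta> where "\<theta> = (\<lambda>k::nat. e * inverse (real (Suc (Suc k))))"
  have \<theta>_pos: "\<theta> k > 0" for k using e(1) by (simp add: \<theta>_def)
  have \<theta>_ball: "\<theta> k \<in> ball 0 e" for k
  proof -
    have "inverse (real (Suc (Suc k))) < 1" by (simp add: inverse_less_1_iff)
    then have "\<theta> k < e" using e(1) by (simp add: \<theta>_def)
    then show ?thesis using \<theta>_pos[of k] by (simp add: dist_real_def)
  qed
  have "(\<lambda>k. inverse (real (Suc (Suc k)))) \<longlonglongrightarrow> 0"
    using LIMSEQ_inverse_real_of_nat LIMSEQ_Suc by blast
  then have "\<theta> \<longlonglongrightarrow> e * 0" unfolding \<theta>_def by (intro tendsto_mult tendsto_const)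
  then have \<theta>_lim: "limitin (top_of_set (ball 0 e)) \<theta> 0 sequentially"
    using \<theta>_ball e(1) by (simp add: limitin_subtopology)
  have "continuous_map (top_of_set (ball 0 e)) (subtopology (Euclidean_space n) (\<phi> ` U)) \<xi>"
    unfolding continuous_map_in_subtopology
    using continuous_map_from_subtopology[OF c\<xi>] e(2) by auto
  from continuous_map_compose[OF this \<psi>(1)]
  have c\<psi>\<xi>: "continuous_map (top_of_set (ball 0 e)) M (\<psi> \<circ> \<xi>)"
    by (simp add: continuous_map_in_subtopology)
  define \<sigma> where "\<sigma> = (\<psi> \<circ> \<xi>) \<circ> \<theta>"
  have "limitin M \<sigma> ((\<psi> \<circ> \<xi>) 0) sequentially"
    unfolding \<sigma>_def by (rule continuous_map_limit[OF c\<psi>\<xi> \<theta>_lim])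
  then have \<sigma>_lim: "limitin M \<sigma> p sequentially" using \<psi>(2)[OF U(2)] \<open>\<xi> 0 = \<phi> p\<close> by simp
  have \<sigma>_in: "\<sigma> k \<in> U \<inter> W" "\<phi> (\<sigma> k) = \<xi> (\<theta> k)" for k
  proof -
    have "\<xi> (\<theta> k) \<in> \<phi> ` (U \<inter> W)" using e(2) \<theta>_ball by blast
    then obtain q where q: "q \<in> U \<inter> W" "\<xi> (\<theta> k) = \<phi> q" by blast
    then have "\<sigma> k = q" unfolding \<sigma>_def using \<psi>(2) by simp
    then show "\<sigma> k \<in> U \<inter> W" "\<phi> (\<sigma> k) = \<xi> (\<theta> k)" using q by simp_all
  qed
  have "\<sigma> k \<in> K" for k using \<sigma>_in(1) W(2) by blast
  then obtain q r where q: "q \<in> K" "strict_mono r" "limitin T (\<sigma> \<circ> r) q sequentially"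
    using seq_compactinD[OF K] by metis
  \<comment> \<open>The leaf topology is finer and \<open>M\<close> is Hausdorff, so the only
    possible limit in the leaf topology is \<open>p\<close>.\<close>
  have "limitin M (\<sigma> \<circ> r) q sequentially"
    using q(3) openin_leaf_topology topspace_T unfolding limitin_def by simp
  then have "q = p"
    by (rule limitin_Hausdorff_unique[OF _ limitin_subsequence[OF q(2) \<sigma>_lim] _ Hausdorff_M]) simp
  define P where "P = {z \<in> U. transverse (\<phi> z) = transverse (\<phi> p)}"
  have "openin T P" unfolding P_def by (rule openin_plaque[OF U(1) c(1) subset_refl])
  moreover have "q \<in> P" using \<open>q = p\<close> U(2) by (simp add: P_def)
  ultimately have "eventually (\<lambda>k. (\<sigma> \<circ> r) k \<in> P) sequentially"
    using q(3) unfolding limitin_def by blast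
  then obtain k where "\<sigma> (r k) \<in> P" by (auto simp: eventually_sequentially)
  \<comment> \<open>Entry 0 of the transverse part is coordinate 1 of the chart, where the two
    points differ by \<open>\<theta> (r k)\<close>.\<close>
  then have "transverse (\<xi> (\<theta> (r k))) 0 = transverse (\<phi> p) 0"
    unfolding P_def \<sigma>_in(2)[symmetric] by simp
  then show False using \<theta>_pos[of "r k"] by (simp add: transverse_def \<xi>_def)
qed

text \<open>The piece of a plaque over an interval \<open>J\<close> of coordinate 0 is a copy of
  \<open>J\<close>, with inverse \<open>k\<close>. Its connectedness in the leaf topology will place
  it inside a single leaf.\<close>

lemma plaque_coordinate:
  assumes p: "p \<in> topspace T"
  obtains N and c :: "'a \<Rightarrow> real" where "openin T N" "p \<in> N" "open (c ` N)" "connectedin T N"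
    "homeomorphic_map (subtopology T N) (top_of_set (c ` N)) c"
proof -
  have pM: "p \<in> topspace M" using p topspace_T by simp
  obtain U \<phi> where U: "(U, \<phi>) \<in> \<F>" "p \<in> U" using chart_at[OF pM] .
  note ch = chartD[OF U(1)]
  obtain \<psi> where \<psi>: "continuous_map (subtopology (Euclidean_space n) (\<phi> ` U)) (subtopology M U) \<psi>"
    "\<And>q. q \<in> U \<Longrightarrow> \<psi> (\<phi> q) = q" "\<And>x. x \<in> \<phi> ` U \<Longrightarrow> \<psi> x \<in> U \<and> \<phi> (\<psi> x) = x"
    using chart_inverse[OF U(1)] by metis
  define y where "y = transverse (\<phi> p)"
  define c where "c = (\<lambda>q. \<phi> q 0)"
  have \<phi>p: "\<phi> p \<in> topspace (Euclidean_space n)" using openin_subset[OF ch(2)] U(2) by blast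
  have cl: "continuous_map euclideanreal (Euclidean_space n) (line_over y)"
    unfolding y_def using continuous_line_over[OF \<phi>p] dim by simp
  have "open {t. line_over y t \<in> \<phi> ` U}"
    using openin_continuous_map_preimage[OF cl ch(2)] by simp
  moreover have "line_over y (c p) = \<phi> p" unfolding y_def c_def by (rule line_over_transverse)
  then have "c p \<in> {t. line_over y t \<in> \<phi> ` U}" using U(2) by simp
  ultimately obtain e where e: "e > 0" "ball (c p) e \<subseteq> {t. line_over y t \<in> \<phi> ` U}"
    using open_contains_ball by blast
  define J where "J = ball (c p) e"
  define k where "k = \<psi> \<circ> line_over y"
  have k: "k t \<in> U" "\<phi> (k t) = line_over y t" if "t \<in> J" for t
    using \<psi>(3)[of "line_over y t"] e(2) that unfolding k_def J_def by auto
  have "continuous_map (top_of_set J) (subtopology (Euclidean_space n) (\<phi> ` U)) (line_over y)"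
    unfolding continuous_map_in_subtopology
    using continuous_map_from_subtopology[OF cl] e(2) unfolding J_def by auto
  from continuous_map_compose[OF this \<psi>(1)]
  have ck: "continuous_map (top_of_set J) M k"
    by (simp add: k_def continuous_map_in_subtopology)
  define N where "N = {q \<in> {q \<in> U. c q \<in> J}. transverse (\<phi> q) = y}"
  have "continuous_map (subtopology M U) (Euclidean_space n) \<phi>"
    using homeomorphic_imp_continuous_map[OF ch(3)] continuous_map_in_subtopology by blast
  then have "continuous_map (subtopology M U) (powertop_real UNIV) \<phi>"
    unfolding Euclidean_space_def continuous_map_in_subtopology by blast
  then have cc: "continuous_map (subtopology M U) euclideanreal c"
    unfolding c_def continuous_map_componentwise_UNIV by blast
  have "openin (subtopology M U) {q \<in> topspace (subtopology M U). c q \<in> J}"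
    by (rule openin_continuous_map_preimage[OF cc]) (simp add: J_def)
  moreover have "topspace (subtopology M U) = U" using openin_subset[OF ch(1)] by auto
  ultimately have "openin M {q \<in> U. c q \<in> J}" using ch(1) openin_trans_full by metis
  then have oN: "openin T N" unfolding N_def by (rule openin_plaque[OF U(1)]) blast
  have pN: "p \<in> N" using U(2) e(1) by (simp add: N_def J_def y_def)
  have kN: "k t \<in> N \<and> c (k t) = t" if "t \<in> J" for t
    using k[OF that] that by (simp add: N_def c_def)
  have ck_N: "c q \<in> J \<and> k (c q) = q" if "q \<in> N" for q
  proof -
    have q: "q \<in> U" "c q \<in> J" "transverse (\<phi> q) = y" using that by (auto simp: N_def)
    have "line_over y (c q) = \<phi> q" unfolding q(3)[symmetric] c_def by (rule line_over_transverse)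
    then show ?thesis using q \<psi>(2) by (simp add: k_def)
  qed
  have "k ` J = N" "c ` N = J" using kN ck_N by force+
  have NT: "N \<subseteq> topspace T" using openin_subset[OF oN] .
  \<comment> \<open>Basic open sets come from arbitrary charts. Along \<open>k\<close> the
    transverse part is constantly \<open>y\<close>, so in another chart it is locally constantly
    \<open>g y\<close>; this is where the compatibility of the foliated charts enters.\<close>
  have kT: "continuous_map (top_of_set J) T k"
    unfolding leaf_topology_def
  proof (rule continuous_on_generated_topo)
    fix G assume "G \<in> {{p \<in> W. transverse (\<phi> p) = y} | W U \<phi> y. (U, \<phi>) \<in> \<F> \<and> openin M W \<and> W \<subseteq> U}"
    then obtain W U' \<phi>' y' where G: "G = {p \<in> W. transverse (\<phi>' p) = y'}" "(U', \<phi>') \<in> \<F>"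
      "openin M W" "W \<subseteq> U'" by blast
    have "openin (top_of_set J) (k -` G \<inter> J)"
    proof (subst openin_subopen, intro ballI)
      fix t assume t: "t \<in> k -` G \<inter> J"
      then have "k t \<in> U" "k t \<in> U'" using k(1)[of t] G(1,4) by auto
      then obtain W' g where W': "openin M W'" "k t \<in> W'" "W' \<subseteq> U \<inter> U'"
        "\<forall>q\<in>W'. transverse (\<phi>' q) = g (transverse (\<phi> q))"
        using chart_transition[OF U(1) G(2)] by metis
      have "openin (top_of_set J) {s \<in> topspace (top_of_set J). k s \<in> W \<inter> W'}"
        by (rule openin_continuous_map_preimage[OF ck]) (use G(3) W'(1) in blast)
      moreover have "t \<in> {s \<in> topspace (top_of_set J). k s \<in> W \<inter> W'}" using t W'(2) G(1) by simp
      moreover have "{s \<in> topspace (top_of_set J). k s \<in> W \<inter> W'} \<subseteq> k -` G \<inter> J"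
      proof
        fix s assume s: "s \<in> {s \<in> topspace (top_of_set J). k s \<in> W \<inter> W'}"
        then have "transverse (\<phi>' (k s)) = g y" using W'(4) k(2)[of s] by simp
        also have "g y = transverse (\<phi>' (k t))" using W'(2,4) k(2)[of t] t by simp
        also have "\<dots> = y'" using t G(1) by simp
        finally show "s \<in> k -` G \<inter> J" using s G(1) by simp
      qed
      ultimately show "\<exists>V. openin (top_of_set J) V \<and> t \<in> V \<and> V \<subseteq> k -` G \<inter> J" by blast
    qed
    then show "openin (top_of_set J) (k -` G \<inter> topspace (top_of_set J))" by simp
  next
    have "topspace T = \<Union>{{p \<in> W. transverse (\<phi> p) = y} | W U \<phi> y. (U, \<phi>) \<in> \<F> \<and> openin M W \<and> W \<subseteq> U}"
      unfolding leaf_topology_def by simp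
    then show "k ` topspace (top_of_set J) \<subseteq> \<Union>{{p \<in> W. transverse (\<phi> p) = y} | W U \<phi> y. (U, \<phi>) \<in> \<F> \<and> openin M W \<and> W \<subseteq> U}"
      using kN NT by auto
  qed
  have "connectedin (top_of_set J) J" by (simp add: J_def connectedin_subtopology)
  then have conn: "connectedin T N"
    using connectedin_continuous_map_image[OF kT] \<open>k ` J = N\<close> by metis
  have "continuous_map (subtopology T N) euclideanreal c"
  proof -
    have "continuous_map (subtopology M N) euclideanreal c"
      by (rule continuous_map_from_subtopology_mono[OF cc]) (auto simp: N_def)
    have "continuous_map T M (\<lambda>q. q)"
      unfolding continuous_map_def
    proof (intro conjI allI impI)
      show "(\<lambda>q. q) \<in> topspace T \<rightarrow> topspace M" using topspace_T by simp
      fix V assume V: "openin M V"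
      have "{q \<in> topspace T. q \<in> V} = V" using openin_subset[OF V] topspace_T by blast
      then show "openin T {q \<in> topspace T. q \<in> V}" using openin_leaf_topology[OF V] by simp
    qed
    then have "continuous_map (subtopology T N) (subtopology M N) (\<lambda>q. q)"
      unfolding continuous_map_in_subtopology by (simp add: continuous_map_from_subtopology)
    from continuous_map_compose[OF this \<open>continuous_map (subtopology M N) euclideanreal c\<close>]
    show ?thesis by (simp only: o_def)
  qed
  then have "continuous_map (subtopology T N) (top_of_set (c ` N)) c"
    by (auto simp: continuous_map_in_subtopology)
  moreover have "continuous_map (top_of_set (c ` N)) (subtopology T N) k"
    using kT kN unfolding \<open>c ` N = J\<close> by (auto simp: continuous_map_in_subtopology)
  ultimately have "homeomorphic_maps (subtopology T N) (top_of_set (c ` N)) c k"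
    unfolding homeomorphic_maps_def using ck_N kN \<open>c ` N = J\<close> by auto
  then have hom: "homeomorphic_map (subtopology T N) (top_of_set (c ` N)) c"
    using homeomorphic_map_maps by blast
  have "open (c ` N)" unfolding \<open>c ` N = J\<close> J_def by simp
  from that[OF oN pN this conn hom] show ?thesis .
qed

text \<open>Leaves are connected components of the leaf topology, so a connected piece of plaque
  that meets \<open>L\<close> lies in \<open>L\<close> and provides a chart of it.\<close>

lemma leaf_curve:
  assumes L: "L \<in> leaves M \<F>"
  shows "curve (subtopology T L)"
proof
  have LC: "L \<in> connected_components_of T" using L by (simp add: leaves_def)
  show "connected_space (subtopology T L)"
    using connectedin_connected_components_of[OF LC] by (simp add: connectedin_def)
  show "Hausdorff_space (subtopology T L)" by (rule Hausdorff_space_subtopology[OF Hausdorff_T])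
  fix p assume "p \<in> topspace (subtopology T L)"
  then have p: "p \<in> topspace T" "p \<in> L" by auto
  obtain N and c :: "'a \<Rightarrow> real" where N: "openin T N" "p \<in> N" "open (c ` N)" "connectedin T N"
    "homeomorphic_map (subtopology T N) (top_of_set (c ` N)) c"
    using plaque_coordinate[OF p(1)] .
  have "\<not> disjnt L N" using p(2) N(2) by (auto simp: disjnt_def)
  then have NL: "N \<subseteq> L" by (rule connected_components_of_maximal[OF LC N(4)])
  then have oN: "openin (subtopology T L) N" using N(1) by (intro subset_openin_subtopology)
  have "subtopology (subtopology T L) N = subtopology T N"
    using NL by (simp add: subtopology_subtopology Int_absorb1)
  then have hom: "homeomorphic_map (subtopology (subtopology T L) N) (top_of_set (c ` N)) c"
    using N(5) by (simp only:)
  show "\<exists>U (\<phi>::'a \<Rightarrow> real). openin (subtopology T L) U \<and> p \<in> U \<and> open (\<phi> ` U) \<and>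
       homeomorphic_map (subtopology (subtopology T L) U) (top_of_set (\<phi> ` U)) \<phi>"
    by (intro exI[of _ N] exI[of _ c] conjI oN N(2,3) hom)
qed

text \<open>The closure of \<open>D\<close> together with the closed set \<open>K\<close> contains
  the dense set \<open>L\<close>, hence is all of \<open>M\<close>. The complement of the closure of
  \<open>D\<close> is then open and inside \<open>K\<close>, so it is empty.\<close>

lemma separable_if_dense_leaf:
  assumes L: "L \<subseteq> topspace M" "M closure_of L = topspace M"
    and D: "countable D" "D \<subseteq> topspace (subtopology T L)" and K: "seq_compactin T K"
    and cover: "topspace (subtopology T L) \<subseteq> subtopology T L closure_of D \<union> K"
  shows "separable_space M"
proof -
  have "subtopology T L closure_of D \<subseteq> T closure_of D"
    by (rule closure_of_subtopology_subset)
  also have "T closure_of D \<subseteq> M closure_of D"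
  proof
    fix x assume x: "x \<in> T closure_of D"
    show "x \<in> M closure_of D"
      unfolding in_closure_of
    proof (intro conjI allI impI)
      show "x \<in> topspace M" using x topspace_T by (simp add: in_closure_of)
      fix V assume "x \<in> V \<and> openin M V"
      then have "x \<in> V \<and> openin T V" using openin_leaf_topology by blast
      with x show "\<exists>y. y \<in> D \<and> y \<in> V" unfolding in_closure_of by blast
    qed
  qed
  finally have "L \<subseteq> M closure_of D \<union> K"
    using cover L(1) topspace_T by auto
  moreover have "closedin M (M closure_of D \<union> K)"
    by (rule closedin_Un[OF closedin_closure_of closedin_M[OF K]])
  ultimately have "M closure_of L \<subseteq> M closure_of D \<union> K" by (rule closure_of_minimal)
  then have "topspace M - M closure_of D \<subseteq> K" unfolding L(2) by blast
  moreover have "openin M (topspace M - M closure_of D)"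
    by (rule openin_diff[OF openin_topspace closedin_closure_of])
  ultimately have "topspace M - M closure_of D = {}" by (intro seq_compactin_empty_interior[OF K])
  then have "M closure_of D = topspace M" using closure_of_subset_topspace[of M D] by blast
  moreover have "D \<subseteq> topspace M" using D(2) topspace_T by auto
  ultimately show ?thesis unfolding separable_space_def using D(1) by blast
qed

lemma dense_leaf:
  assumes L: "L \<in> leaves M \<F>" and dense: "M closure_of L = topspace M"
  shows "(subtopology T L homeomorphic_space euclideanreal \<or>
          subtopology T L homeomorphic_space long_ray) \<and> separable_space M"
proof -
  let ?X = "subtopology T L"
  have LC: "L \<in> connected_components_of T" using L by (simp add: leaves_def)
  then have LM: "L \<subseteq> topspace M" using connected_components_of_subset topspace_T by metis
  then have top: "topspace ?X = L" using topspace_T by auto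
  have ne: "L \<noteq> {}" using nonempty_connected_components_of[OF LC] .
  have ns: "\<not> seq_compactin ?X (topspace ?X)"
  proof
    assume "seq_compactin ?X (topspace ?X)"
    then have K: "seq_compactin T L" using seq_compactin_subtopology_imp top by metis
    then have "M closure_of L = L" using closedin_M closure_of_closedin by blast
    then have "topspace M \<subseteq> L" using dense by simp
    then have "topspace M = {}" by (rule seq_compactin_empty_interior[OF K openin_topspace])
    then show False using ne LM by blast
  qed
  have "noncompact_curve ?X"
    using leaf_curve[OF L] ns unfolding noncompact_curve_def noncompact_curve_axioms_def by blast
  then obtain r where "ordered_curve ?X r" using noncompact_curve.ex_ordered_curve by blast
  from ordered_curve.classification[OF this] ne ns top
  consider "?X homeomorphic_space euclideanreal" | "?X homeomorphic_space long_ray"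
      "\<exists>K D. seq_compactin ?X K \<and> countable D \<and> D \<subseteq> topspace ?X \<and> topspace ?X \<subseteq> ?X closure_of D \<union> K"
    by metis
  then show ?thesis
  proof cases
    case 1
    then have "separable_space ?X" using homeomorphic_separable_space separable_euclideanreal by blast
    then obtain D where D: "countable D" "D \<subseteq> topspace ?X" "?X closure_of D = topspace ?X"
      unfolding separable_space_def by blast
    \<comment> \<open>A leaf homeomorphic to the reals is itself separable, so the sequentially
      compact rest can be taken empty.\<close>
    have "seq_compactin T {}" by (simp add: seq_compactin_def)
    from separable_if_dense_leaf[OF LM dense D(1,2) this] D(3) 1 show ?thesis by simp
  next
    case 2
    then obtain K D where K: "seq_compactin ?X K" and D: "countable D" "D \<subseteq> topspace ?X"
      "topspace ?X \<subseteq> ?X closure_of D \<union> K" by blast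
    from separable_if_dense_leaf[OF LM dense D(1,2) seq_compactin_subtopology_imp[OF K] D(3)] 2(1)
    show ?thesis by blast
  qed
qed

end

theorem proposition7p3:
  fixes M :: "'a topology" and n :: nat
    and \<F> :: "('a set \<times> ('a \<Rightarrow> nat \<Rightarrow> real)) set" and L :: "'a set"
  assumes "n \<ge> 2" and "manifold n M" and "foliation1 n M \<F>"
    and "L \<in> leaves M \<F>" and "M closure_of L = topspace M"
  shows "(subtopology (leaf_topology M \<F>) L homeomorphic_space euclideanreal \<or>
          subtopology (leaf_topology M \<F>) L homeomorphic_space long_ray) \<and>
         separable_space M"
proof -
  interpret foliated_manifold n M \<F>
    using assms(1-3) by (simp add: foliated_manifold_def)
  show ?thesis by (rule dense_leaf[OF assms(4,5)])
qed

end
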